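(* Let $N$ be a positive integer, let $(r_\delta)_{\delta \mid N}$ be integers indexed by the positive divisors $\delta$ of $N$, and let $$g(z)=\prod_{\delta\mid N}\eta(\delta z)^{r_\delta}$$ for $z$ in the upper half plane. Suppose that: 1. $\sum_{\delta\mid N} r_\delta\cdot\delta\equiv 0 \pmod{24}$, 2. $\sum_{\delta\mid N} r_\delta\cdot (N/\delta)\equiv 0 \pmod{24}$, and 3. $\sum_{\delta\mid N} r_\delta = 0$. Then $g(z)$ is a modular function of weight $0$ for $\Gamma_0(N)$ with quadratic character $\chi:=\prod_{\delta\mid N}\left(\frac{N/\delta}{\cdot}\right)^{r_\delta}$.
   Context: The Dedekind eta function is defined for $z$ in the upper half plane by $\eta(z)=q^{1/24}\prod_{n=1}^\infty(1-q^n)$, where $q=\exp(2\pi i z)$ and $q^{1/24}=\exp(2\pi i z/24)$. $\Gamma_0(N)$ is the group of matrices $\begin{pmatrix}a&b\\c&d\end{pmatrix}\in\mathrm{SL}_2(\mathbf{Z})$ with $N\mid c$. $\left(\frac{m}{\cdot}\right)$ denotes the quadratic residue (Jacobi/Kronecker) symbol, so that $\chi(a)=\prod_{\delta\mid N}\left(\frac{N/\delta}{a}\right)^{r_\delta}\in\{\pm1\}$ for $a$ coprime to $N$. "Quadratic" means that $\chi$ takes values in $\{\pm 1\}$; it may be trivial. A modular function of weight $0$ for $\Gamma_0(N)$ with quadratic character $\chi$ is a meromorphic function $g$ on the upper half plane, meromorphic at the cusps, such that $g\left(\frac{az+b}{cz+d}\right)=\chi(a)\,g(z)$ for all $\begin{pmatrix}a&b\\c&d\end{pmatrix}\in\Gamma_0(N)$.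 Since $ad\equiv1\pmod N$ and $\chi$ is a quadratic character, $\chi(a)=\chi(d)$. *)

theory Defs
  imports "HOL-Complex_Analysis.Complex_Analysis" "HOL-Number_Theory.Number_Theory"
begin

definition upper_half_plane :: "complex set" where
  "upper_half_plane = {z. Im z > 0}"

definition dedekind_eta :: "complex \<Rightarrow> complex" where
  "dedekind_eta z =
     exp (2 * of_real pi * \<i> * z / 24) * (\<Prod>n. 1 - exp (2 * of_real pi * \<i> * z) ^ Suc n)"

definition SL2Z :: "(int ^ 2 ^ 2) set" where
  "SL2Z = {A. det A = 1}"

definition Gamma0 :: "nat \<Rightarrow> (int ^ 2 ^ 2) set" where
  "Gamma0 N = {A \<in> SL2Z. int N dvd A $ 2 $ 1}"

definition moebius :: "int ^ 2 ^ 2 \<Rightarrow> complex \<Rightarrow> complex" where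
  "moebius A z = (of_int (A $ 1 $ 1) * z + of_int (A $ 1 $ 2)) /
                 (of_int (A $ 2 $ 1) * z + of_int (A $ 2 $ 2))"

text \<open>The Kronecker symbol $(m/n)$, the extension of the Jacobi symbol to arbitrary integers $n$.
  For odd $N$ the top left entry of a matrix in $\Gamma_0(N)$ may be even, so the symbol is
  needed beyond odd $n$.\<close>

definition kronecker_prime :: "int \<Rightarrow> int \<Rightarrow> int" where
  "kronecker_prime m p =
     (if p = 2 then (if even m then 0 else if m mod 8 \<in> {1, 7} then 1 else -1)
      else Legendre m p)"

definition kronecker :: "int \<Rightarrow> int \<Rightarrow> int" where
  "kronecker m n =
     (if n = 0 then (if \<bar>m\<bar> = 1 then 1 else 0)
      else (if n < 0 \<and> m < 0 then -1 else 1) *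
           (\<Prod>p\<in>prime_factors n. kronecker_prime m p ^ multiplicity p n))"

text \<open>A character modulo $N$ is represented by its values on integers; the values at integers
  not coprime to $N$ are irrelevant.\<close>

definition quadratic_character :: "nat \<Rightarrow> (int \<Rightarrow> complex) \<Rightarrow> bool" where
  "quadratic_character N ch \<longleftrightarrow>
     (\<forall>a. coprime a (int N) \<longrightarrow> ch a \<in> {1, -1}) \<and>
     (\<forall>a b. coprime a (int N) \<longrightarrow> [a = b] (mod int N) \<longrightarrow> ch a = ch b) \<and>
     (\<forall>a b. coprime a (int N) \<longrightarrow> coprime b (int N) \<longrightarrow> ch (a * b) = ch a * ch b)"

text \<open>Every cusp has the form $A\infty$ with $A \in \mathrm{SL}_2(\mathbf{Z})$; near it, the function
  must have a Laurent expansion with finite principal part in $q^{1/h} = \exp(2 \pi i z / h)$.\<close>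

definition meromorphic_at_cusps :: "(complex \<Rightarrow> complex) \<Rightarrow> bool" where
  "meromorphic_at_cusps g \<longleftrightarrow>
     (\<forall>A\<in>SL2Z. \<exists>h::nat. h > 0 \<and> (\<exists>F y. F meromorphic_on {0} \<and> y > 0 \<and>
        (\<forall>z. Im z > y \<longrightarrow> g (moebius A z) = F (exp (2 * of_real pi * \<i> * z / of_nat h)))))"

text \<open>A meromorphic function is normalised to have no removable singularities and to take the
  value 0 at its poles, so that the pointwise transformation law is meaningful there.\<close>

definition modular_function_Gamma0 ::
  "nat \<Rightarrow> (int \<Rightarrow> complex) \<Rightarrow> (complex \<Rightarrow> complex) \<Rightarrow> bool" where
  "modular_function_Gamma0 N ch g \<longleftrightarrow>
     quadratic_character N ch \<and>
     g nicely_meromorphic_on upper_half_plane \<and>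
     meromorphic_at_cusps g \<and>
     (\<forall>A\<in>Gamma0 N. \<forall>z\<in>upper_half_plane. g (moebius A z) = ch (A $ 1 $ 1) * g z)"

definition eta_quotient :: "nat \<Rightarrow> (nat \<Rightarrow> int) \<Rightarrow> complex \<Rightarrow> complex" where
  "eta_quotient N r z = (\<Prod>\<delta> | \<delta> dvd N. dedekind_eta (of_nat \<delta> * z) powi r \<delta>)"

definition eta_character :: "nat \<Rightarrow> (nat \<Rightarrow> int) \<Rightarrow> int \<Rightarrow> complex" where
  "eta_character N r a = (\<Prod>\<delta> | \<delta> dvd N. of_int (kronecker (int (N div \<delta>)) a) powi r \<delta>)"

end

theory Submission imports Defs begin

text \<open>For \<open>A = (a, b; c, d)\<close> in \<open>SL\<^sub>2(\<int>)\<close> with \<open>a\<close> odd the eta multiplier is explicit: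
  \<open>\<eta>(Az) = (c/a) exp(\<pi>iQ/12) \<surd>(cz + d) \<eta>(z)\<close> with the Kronecker symbol and an integer polynomial
  \<open>Q\<close> in the entries. Multiplying \<open>A\<close> on the left by powers of \<open>(1, 0; 1, 1)\<close> and \<open>(1, 4; 0, 1)\<close> keeps
  \<open>a\<close> odd and, as in Euclid's algorithm, leads to \<open>c = 0\<close>; the formula is compatible with both steps by
  the periodicity of the Kronecker symbol, that is, by quadratic reciprocity. For \<open>\<delta>\<close> dividing \<open>N\<close> and
  \<open>A\<close> in \<open>\<Gamma>\<^sub>0(N)\<close>, \<open>\<delta>Az = A\<^sub>\<delta>(\<delta>z)\<close> with \<open>A\<^sub>\<delta> = (a, \<delta>b; c/\<delta>, d)\<close>, and the hypotheses are exactly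
  what makes the roots of unity and the weight factors cancel in the product over \<open>\<delta>\<close>.

  The inversion formula for \<open>\<eta>\<close> comes from the product for Jacobi's \<open>\<theta>\<^sub>1\<close>: the functions \<open>\<theta>\<^sub>1\<close> of the
  lattices \<open>\<int> + iy\<int>\<close> and \<open>\<int> + (i/y)\<int>\<close> are proportional by Liouville's theorem, and the derivative at 0
  together with the values at the three half periods determines the constant.\<close>

section \<open>The Kronecker symbol\<close>

text \<open>Left multiplication by T = (1, 1; 0, 1) replaces \<open>a\<close> by the odd number a +
  c, so everything hinges on the character having period \<open>N\<close>. For odd arguments this
  period is read off from the eta quotient itself, which is invariant under z -> z + 1 and has no
  zeros. The other obstacle is the branch of the square root. Principal roots multiply only up to a
  sign; the Kronecker symbol with negative lower argument changes sign on exactly the same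
  occasions, so one formula holds for all signs of \<open>c\<close> and \<open>d\<close>. The step
  length 4 keeps \<open>a\<close> odd, fits the period 4c of the symbol with upper argument
  \<open>c\<close>, and leaves no gap in the descent: only |a| = 2|c| would block it, and
  \<open>a\<close> is odd. At the cusps arbitrary elements of \<open>SL2Z\<close> occur, but the
  multiplier is irrelevant there. The square of eta avoids the root altogether, and the sign lost by
  squaring is constant by connectedness.\<close>

lemma Legendre_values: "Legendre a p \<in> {-1, 0, 1}"
  by (auto simp: Legendre_def)

lemma Legendre_cong: "[a = b] (mod p) \<Longrightarrow> Legendre a p = Legendre b p"
  by (simp add: Legendre_def QuadRes_def cong_def)

text \<open>Two elements of {-1, 0, 1} differ by at most 2 < p. This turns the congruences of
  Euler's criterion into equations.\<close>

lemma Legendre_eq_if_cong: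
  assumes "[Legendre a p = x] (mod p)" "x \<in> {-1, 0, 1}" "p > 2"
  shows "Legendre a p = x"
proof (rule ccontr)
  assume "Legendre a p \<noteq> x"
  moreover have "p dvd Legendre a p - x"
    using assms(1) by (simp add: cong_iff_dvd_diff)
  ultimately have "p \<le> \<bar>Legendre a p - x\<bar>"
    using dvd_imp_le_int[of "Legendre a p - x" p] assms(3) by auto
  thus False
    using assms Legendre_values[of a p] by auto
qed

lemma Legendre_euler_int:
  fixes p :: int
  assumes "prime p" "p > 2"
  shows "[Legendre a p = a ^ ((nat p - 1) div 2)] (mod p)"
  using euler_criterion[of "nat p" a] assms by auto

lemma Legendre_mult:
  fixes p :: int
  assumes "prime p" "p > 2"
  shows "Legendre (a * b) p = Legendre a p * Legendre b p"
proof (rule Legendre_eq_if_cong)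
  have "[Legendre (a * b) p = (a * b) ^ ((nat p - 1) div 2)] (mod p)"
    by (rule Legendre_euler_int[OF assms])
  also have "(a * b) ^ ((nat p - 1) div 2) = a ^ ((nat p - 1) div 2) * b ^ ((nat p - 1) div 2)"
    by (rule power_mult_distrib)
  also have "[\<dots> = Legendre a p * Legendre b p] (mod p)"
    by (intro cong_mult cong_sym[OF Legendre_euler_int[OF assms]])
  finally show "[Legendre (a * b) p = Legendre a p * Legendre b p] (mod p)" .
  show "Legendre a p * Legendre b p \<in> {-1, 0, 1}"
    using Legendre_values[of a p] Legendre_values[of b p] by auto
qed (use assms in auto)

lemma Legendre_minus_one:
  fixes p :: int
  assumes "prime p" "p > 2"
  shows "Legendre (-1) p = (if p mod 4 = 1 then 1 else -1)"
proof (rule Legendre_eq_if_cong)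
  have "odd p" using assms prime_odd_int by auto
  have "(-1) ^ ((nat p - 1) div 2) = (if p mod 4 = 1 then 1 else -1 :: int)"
  proof (cases "p mod 4 = 1")
    case True
    hence "p = 4 * (p div 4) + 1" by presburger
    hence "nat p = 2 * (2 * nat (p div 4)) + 1" using assms(2) by linarith
    thus ?thesis using True by simp
  next
    case False
    hence "p mod 4 = 3" using \<open>odd p\<close> by presburger
    then obtain x where x: "p = 4 * x + 3" by (metis div_mult_mod_eq mult.commute)
    hence "x \<ge> 0" using assms(2) by linarith
    hence "nat p = 2 * (2 * nat x + 1) + 1" using x by (simp add: nat_add_distrib nat_mult_distrib)
    thus ?thesis using False by simp
  qed
  thus "[Legendre (-1) p = (if p mod 4 = 1 then 1 else -1)] (mod p)"
    using Legendre_euler_int[OF assms, of "-1"] by (simp only:)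
qed (use assms in auto)

lemma odd_prime_gt_2_int: "prime (p::int) \<Longrightarrow> p \<noteq> 2 \<Longrightarrow> p > 2"
  using prime_ge_2_int[of p] by linarith

text \<open>The classes 1 and 7 form a subgroup of index 2 in the units modulo 8; hence
  \<open>kronecker_prime\<close> is multiplicative at the prime 2.\<close>

lemma mod_8_mult_in_1_7_iff:
  fixes m m' :: int
  assumes "odd m" "odd m'"
  shows "(m * m') mod 8 \<in> {1, 7} \<longleftrightarrow> (m mod 8 \<in> {1, 7} \<longleftrightarrow> m' mod 8 \<in> {1, 7})"
proof -
  have "m mod 8 \<in> {1, 3, 5, 7}" "m' mod 8 \<in> {1, 3, 5, 7}"
    using assms by auto presburger+
  thus ?thesis
    using mod_mult_eq[of m 8 m'] by auto
qed

lemma kronecker_prime_mult: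
  assumes "prime p"
  shows "kronecker_prime (m * m') p = kronecker_prime m p * kronecker_prime m' p"
  using mod_8_mult_in_1_7_iff[of m m'] Legendre_mult[OF assms odd_prime_gt_2_int[OF assms]]
  unfolding kronecker_prime_def by auto

lemma kronecker_prime_values: "kronecker_prime m p \<in> {-1, 0, 1}"
  using Legendre_values[of m p] by (auto simp: kronecker_prime_def)

lemma kronecker_prime_eq_0_iff: "kronecker_prime m p = 0 \<longleftrightarrow> p dvd m"
  by (auto simp: kronecker_prime_def Legendre_def cong_0_iff)

text \<open>A common index set allows the symbols at x, y and x * y to be compared factor by factor;
  additional primes have multiplicity 0.\<close>

lemma kronecker_eq_prod:
  assumes "n \<noteq> 0" "finite S" "prime_factors n \<subseteq> S" "\<And>p. p \<in> S \<Longrightarrow> prime p"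
  shows "kronecker m n = (if n < 0 \<and> m < 0 then -1 else 1) *
           (\<Prod>p\<in>S. kronecker_prime m p ^ multiplicity p n)"
proof -
  have "(\<Prod>p\<in>prime_factors n. kronecker_prime m p ^ multiplicity p n) =
        (\<Prod>p\<in>S. kronecker_prime m p ^ multiplicity p n)"
  proof (rule prod.mono_neutral_left)
    show "\<forall>i\<in>S - prime_factors n. kronecker_prime m i ^ multiplicity i n = 1"
      using assms by (auto simp: prime_factors_multiplicity)
  qed (use assms in auto)
  thus ?thesis using assms by (simp add: kronecker_def)
qed

lemma kronecker_mult_right:
  assumes "x \<noteq> 0" "y \<noteq> 0"
  shows "kronecker m (x * y) = kronecker m x * kronecker m y"
proof -
  define S where "S = prime_factors x \<union> prime_factors y"
  have S: "finite S" "prime_factors x \<subseteq> S" "prime_factors y \<subseteq> S" "prime_factors (x * y) \<subseteq> S"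
    "\<And>p. p \<in> S \<Longrightarrow> prime p"
    using assms by (auto simp: S_def prime_factors_product)
  have "(\<Prod>p\<in>S. kronecker_prime m p ^ multiplicity p (x * y)) =
        (\<Prod>p\<in>S. kronecker_prime m p ^ multiplicity p x) * (\<Prod>p\<in>S. kronecker_prime m p ^ multiplicity p y)"
    unfolding prod.distrib[symmetric]
  proof (intro prod.cong refl)
    fix p assume "p \<in> S"
    hence "prime_elem p" using S(5) by blast
    thus "kronecker_prime m p ^ multiplicity p (x * y) =
      kronecker_prime m p ^ multiplicity p x * kronecker_prime m p ^ multiplicity p y"
      using prime_elem_multiplicity_mult_distrib[of p x y] assms by (simp add: power_add)
  qed
  thus ?thesis
    using kronecker_eq_prod[of x S m] kronecker_eq_prod[of y S m] kronecker_eq_prod[of "x * y" S m] 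
      S assms by (auto simp: mult_less_0_iff)
qed

lemma kronecker_1_right [simp]: "kronecker m 1 = 1"
  by (simp add: kronecker_def)

lemma kronecker_minus_1_right: "kronecker m (-1) = (if m < 0 then -1 else 1)"
  by (simp add: kronecker_def prime_factorization_unit)

lemma kronecker_prime_right: "prime p \<Longrightarrow> kronecker m p = kronecker_prime m p"
  using prime_gt_0_int[of p] by (simp add: kronecker_def prime_factorization_prime)

text \<open>The sign rule at n = -1 dictates the hypothesis: for m = -1 and m' = 0 the left side is
  1 and the right side -1. The first alternative admits m = 0, which occurs when the lower left
  entry of the matrix vanishes.\<close>

lemma kronecker_mult_left:
  assumes "n \<noteq> 0" "m' > 0 \<or> (m \<noteq> 0 \<and> m' \<noteq> 0)"
  shows "kronecker (m * m') n = kronecker m n * kronecker m' n"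
  using assms(1)
proof (induction n rule: prime_divisors_induct)
  case zero
  thus ?case by simp
next
  case (unit n)
  hence "n = 1 \<or> n = -1" by auto
  thus ?case using assms by (auto simp: kronecker_minus_1_right mult_less_0_iff)
next
  case (factor p n)
  hence "p \<noteq> 0" "n \<noteq> 0" by auto
  thus ?case using factor
    by (simp add: kronecker_mult_right kronecker_prime_right kronecker_prime_mult)
qed

lemma kronecker_1_left [simp]: "kronecker 1 n = 1"
proof (cases "n = 0")
  case False
  have "kronecker_prime 1 p = 1" if "prime p" for p
  proof -
    have "kronecker_prime 1 p \<noteq> 0"
      using that by (auto simp: kronecker_prime_eq_0_iff)
    moreover have "kronecker_prime 1 p = kronecker_prime 1 p * kronecker_prime 1 p"
      using kronecker_prime_mult[OF that, of 1 1] by simp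
    ultimately show ?thesis by simp
  qed
  thus ?thesis by (simp add: kronecker_def in_prime_factors_iff)
qed (simp add: kronecker_def)

lemma kronecker_values_coprime:
  assumes "coprime m n"
  shows "kronecker m n \<in> {1, -1}"
  using assms
proof (induction n rule: prime_divisors_induct)
  case zero
  thus ?case by (auto simp: kronecker_def)
next
  case (unit n)
  hence "n = 1 \<or> n = -1" by auto
  thus ?case by (auto simp: kronecker_minus_1_right)
next
  case (factor p n)
  have p: "kronecker_prime m p \<noteq> 0"
    using factor.hyps factor.prems
    by (metis coprime_common_divisor dvd_triv_left kronecker_prime_eq_0_iff not_prime_unit)
  show ?case
  proof (cases "n = 0")
    case True
    thus ?thesis using factor by simp
  next
    case False
    have "kronecker m n \<in> {1, -1}" using factor by simp
    thus ?thesis using p kronecker_prime_values[of m p] factor.hyps False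
      by (auto simp: kronecker_mult_right kronecker_prime_right)
  qed
qed

lemma odd_prime_induct_int [consumes 2, case_names one factor]:
  fixes n :: int
  assumes "n > 0" "odd n" and "P 1"
    and "\<And>p n. prime p \<Longrightarrow> p > 2 \<Longrightarrow> n > 0 \<Longrightarrow> odd n \<Longrightarrow> odd p \<Longrightarrow> P n \<Longrightarrow> P (p * n)"
  shows "P n"
  using assms(1,2)
proof (induction n rule: prime_divisors_induct)
  case (unit n)
  thus ?case using assms(3) by auto
next
  case (factor p n)
  hence "p > 0" "odd p" "p \<noteq> 2" by (auto simp: prime_gt_0_int)
  thus ?case using factor assms(4)[of p n] odd_prime_gt_2_int[of p]
    by (auto simp: zero_less_mult_iff)
qed auto

lemma kronecker_cong_left_odd:
  assumes "n > 0" "odd n" "[m = m'] (mod n)"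
  shows "kronecker m n = kronecker m' n"
  using assms
proof (induction n rule: odd_prime_induct_int)
  case (factor p n)
  have "[m = m'] (mod p)" "[m = m'] (mod n)"
    using factor.prems by (auto simp: cong_iff_dvd_diff intro: dvd_mult_left dvd_mult_right)
  thus ?case using factor Legendre_cong[of m m' p]
    by (simp add: kronecker_mult_right kronecker_prime_right kronecker_prime_def)
qed auto

lemma odd_mod_4_cases: "odd (n::int) \<Longrightarrow> n mod 4 = 1 \<or> n mod 4 = 3"
  by presburger

lemma mult_mod_4_eq_1_iff:
  fixes m n :: int
  assumes "odd m" "odd n"
  shows "(m * n) mod 4 = 1 \<longleftrightarrow> (m mod 4 = 1 \<longleftrightarrow> n mod 4 = 1)"
  using odd_mod_4_cases[OF assms(1)] odd_mod_4_cases[OF assms(2)] mod_mult_eq[of m 4 n] by auto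

lemma kronecker_minus_1_left_pos:
  assumes "n > 0" "odd n"
  shows "kronecker (-1) n = (if n mod 4 = 1 then 1 else -1)"
  using assms
proof (induction n rule: odd_prime_induct_int)
  case (factor p n)
  thus ?case
    by (simp add: kronecker_mult_right kronecker_prime_right kronecker_prime_def
          Legendre_minus_one mult_mod_4_eq_1_iff)
qed simp

lemma kronecker_minus_right:
  assumes "n \<noteq> 0"
  shows "kronecker m (-n) = kronecker m n * (if m < 0 then -1 else 1)"
  using kronecker_mult_right[of n "-1" m] assms by (simp add: kronecker_minus_1_right)

lemma kronecker_minus_1_left:
  assumes "odd n"
  shows "kronecker (-1) n = (if n mod 4 = 1 then 1 else -1)"
proof (cases "n > 0")
  case False
  hence n: "-n > 0" "odd (-n)" "n \<noteq> 0" using assms by (auto simp: not_less order_le_less)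
  have "kronecker (-1) n = - kronecker (-1) (-n)"
    using kronecker_minus_right[of "-n" "-1"] n by simp
  also have "\<dots> = (if n mod 4 = 1 then 1 else -1)"
    using kronecker_minus_1_left_pos[OF n(1,2)] odd_mod_4_cases[OF assms] by (auto; presburger)
  finally show ?thesis .
qed (use kronecker_minus_1_left_pos assms in auto)

section \<open>Quadratic reciprocity and periodicity of the Kronecker symbol\<close>

text \<open>For odd arguments this is (-1)^((m-1)/2 * (n-1)/2); the form by residues modulo 4 makes
  sense for negative arguments without an exponent.\<close>

definition recip_sign :: "int \<Rightarrow> int \<Rightarrow> int" where
  "recip_sign m n = (if m mod 4 = 1 \<or> n mod 4 = 1 then 1 else -1)"

lemma recip_sign_mult_right:
  "odd n \<Longrightarrow> odd n' \<Longrightarrow> recip_sign m (n * n') = recip_sign m n * recip_sign m n'"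
  by (auto simp: recip_sign_def mult_mod_4_eq_1_iff)

lemma recip_sign_commute: "recip_sign m n = recip_sign n m"
  by (auto simp: recip_sign_def)

lemma Legendre_reciprocity:
  fixes p q :: int
  assumes "prime p" "prime q" "p > 2" "q > 2" "p \<noteq> q"
  shows "Legendre p q = Legendre q p * recip_sign p q"
proof -
  have odd: "odd p" "odd q" using assms prime_odd_int by auto
  have "\<not> p dvd q" using assms primes_dvd_imp_eq by blast
  hence nz: "Legendre q p \<in> {1, -1}"
    by (auto simp: Legendre_def cong_0_iff)
  have *: "even ((p - 1) div 2 * ((q - 1) div 2)) \<longleftrightarrow> p mod 4 = 1 \<or> q mod 4 = 1"
  proof -
    have "even ((p - 1) div 2) \<longleftrightarrow> p mod 4 = 1" "even ((q - 1) div 2) \<longleftrightarrow> q mod 4 = 1"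
      using odd by presburger+
    thus ?thesis by simp
  qed
  have nn: "(p - 1) div 2 * ((q - 1) div 2) \<ge> 0" using assms by simp
  have "Legendre p q * Legendre q p = (-1) ^ nat ((p - 1) div 2 * ((q - 1) div 2))"
    by (rule Quadratic_Reciprocity_int) (use assms in auto)
  also have "\<dots> = recip_sign p q"
    using * nn by (simp add: recip_sign_def uminus_power_if even_nat_iff)
  finally show ?thesis using nz by auto
qed

lemma kronecker_reciprocity_prime:
  assumes "prime p" "p > 2" "n > 0" "odd n" "coprime p n"
  shows "kronecker p n = kronecker n p * recip_sign p n"
  using assms(3,4,5)
proof (induction n rule: odd_prime_induct_int)
  case one
  thus ?case by (simp add: recip_sign_def)
next
  case (factor q n)
  have "p \<noteq> q" using factor.prems \<open>prime p\<close> by auto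
  thus ?case
    using factor assms(1,2) Legendre_reciprocity[of p q]
    by (simp add: kronecker_mult_right kronecker_mult_left kronecker_prime_right kronecker_prime_def
         recip_sign_mult_right Legendre_mult)
qed

lemma kronecker_reciprocity_pos:
  assumes "m > 0" "odd m" "n > 0" "odd n" "coprime m n"
  shows "kronecker m n = kronecker n m * recip_sign m n"
  using assms(1,2,5)
proof (induction m rule: odd_prime_induct_int)
  case one
  thus ?case by (simp add: recip_sign_def)
next
  case (factor p m)
  have "coprime p n" "coprime m n" using factor.prems by simp_all
  thus ?case
    using factor assms(3,4) kronecker_reciprocity_prime[of p n]
    by (simp add: kronecker_mult_right kronecker_mult_left recip_sign_mult_right recip_sign_commute[of _ n])
qed

text \<open>For negative \<open>n\<close>, the sign factor at -1 is trivial because m > 0, and the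
  factor (-1/m) split off from (-n/m) accounts for the change of \<open>recip_sign\<close> between n
  and -n.\<close>

lemma kronecker_reciprocity:
  assumes "m > 0" "odd m" "odd n" "coprime m n"
  shows "kronecker m n = kronecker n m * recip_sign m n"
proof (cases "n > 0")
  case False
  hence n: "-n > 0" "odd (-n)" "n \<noteq> 0" using assms by (auto simp: not_less order_le_less)
  have "kronecker m n = kronecker m (-n)"
    using kronecker_minus_right[of "-n" m] n assms by simp
  also have "\<dots> = kronecker (-n) m * recip_sign m (-n)"
    using kronecker_reciprocity_pos[of m "-n"] assms n by simp
  also have "kronecker (-n) m = kronecker n m * kronecker (-1) m"
    using kronecker_mult_left[of m n "-1"] assms n by simp
  also have "kronecker n m * kronecker (-1) m * recip_sign m (-n) = kronecker n m * recip_sign m n"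
    using odd_mod_4_cases[OF assms(2)] odd_mod_4_cases[OF assms(3)] assms(2)
    by (auto simp: kronecker_minus_1_left recip_sign_def) presburger+
  finally show ?thesis .
qed (use kronecker_reciprocity_pos assms in auto)

text \<open>Since \<open>n\<close> and \<open>n - 2\<close> are not both 3 modulo 4, reciprocity gives
  \<open>(2/n) = (-1/n) ((n-2)/n) = (-1/n) (n/(n-2)) = (-1/n) (2/(n-2))\<close>.\<close>

lemma kronecker_2_left_pos:
  assumes "n > 0" "odd n"
  shows "kronecker 2 n = (if n mod 8 \<in> {1, 7} then 1 else -1)"
proof -
  have "kronecker 2 (2 * int k + 1) = (if (2 * int k + 1) mod 8 \<in> {1, 7} then 1 else -1)" for k
  proof (induction k)
    case (Suc k)
    define n where "n = 2 * int k + 1"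
    have n: "odd n" "n > 0" "odd (n + 2)" "n + 2 > 0" by (auto simp: n_def)
    have cop: "coprime n (n + 2)"
    proof -
      have "coprime n 2" using n by simp
      thus ?thesis by (simp add: coprime_iff_gcd_eq_1)
    qed
    have "kronecker 2 (n + 2) * kronecker (-1) (n + 2) = kronecker (-2) (n + 2)"
      using kronecker_mult_left[of "n + 2" 2 "-1"] n by simp
    also have "\<dots> = kronecker n (n + 2)"
    proof (rule kronecker_cong_left_odd)
      have "-2 - n = (n + 2) * (-1)" by simp
      thus "[-2 = n] (mod n + 2)" unfolding cong_iff_dvd_diff by (metis dvd_triv_left)
    qed (use n in auto)
    also have "\<dots> = kronecker (n + 2) n * recip_sign n (n + 2)"
      by (rule kronecker_reciprocity) (use n cop in auto)
    also have "recip_sign n (n + 2) = 1"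
      using n odd_mod_4_cases[of n] by (auto simp: recip_sign_def) presburger
    also have "kronecker (n + 2) n = kronecker 2 n"
      by (rule kronecker_cong_left_odd) (use n in \<open>auto simp: cong_iff_dvd_diff\<close>)
    also have "\<dots> = (if n mod 8 \<in> {1, 7} then 1 else -1)"
      using Suc by (simp add: n_def)
    finally have *: "kronecker 2 (n + 2) * (if (n + 2) mod 4 = 1 then 1 else -1) =
                     (if n mod 8 \<in> {1, 7} then 1 else -1)"
      using n by (simp add: kronecker_minus_1_left)
    have "n mod 8 = 1 \<or> n mod 8 = 3 \<or> n mod 8 = 5 \<or> n mod 8 = 7"
      using n(1) by presburger
    moreover have "n mod 8 = 1 \<Longrightarrow> (n + 2) mod 8 = 3" "n mod 8 = 1 \<Longrightarrow> (n + 2) mod 4 = 3"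
      "n mod 8 = 3 \<Longrightarrow> (n + 2) mod 8 = 5" "n mod 8 = 3 \<Longrightarrow> (n + 2) mod 4 = 1"
      "n mod 8 = 5 \<Longrightarrow> (n + 2) mod 8 = 7" "n mod 8 = 5 \<Longrightarrow> (n + 2) mod 4 = 3"
      "n mod 8 = 7 \<Longrightarrow> (n + 2) mod 8 = 1" "n mod 8 = 7 \<Longrightarrow> (n + 2) mod 4 = 1"
      by presburger+
    ultimately have "kronecker 2 (n + 2) = (if (n + 2) mod 8 \<in> {1, 7} then 1 else -1)"
      using * by (elim disjE) simp_all
    moreover have "2 * int (Suc k) + 1 = n + 2" by (simp add: n_def)
    ultimately show ?case by (simp only:)
  qed simp
  moreover have "n = 2 * int (nat (n div 2)) + 1" using assms by (auto elim!: oddE)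
  ultimately show ?thesis by metis
qed

lemma kronecker_2_left:
  assumes "odd n"
  shows "kronecker 2 n = (if n mod 8 \<in> {1, 7} then 1 else -1)"
proof (cases "n > 0")
  case False
  hence n: "-n > 0" "odd (-n)" "n \<noteq> 0" using assms by (auto simp: not_less order_le_less)
  have "kronecker 2 n = kronecker 2 (-n)"
    using kronecker_minus_right[of "-n" 2] n by simp
  also have "\<dots> = (if (-n) mod 8 \<in> {1, 7} then 1 else -1)"
    using kronecker_2_left_pos[OF n(1,2)] .
  also have "(-n) mod 8 \<in> {1, 7} \<longleftrightarrow> n mod 8 \<in> {1, 7}" by auto presburger+
  finally show ?thesis .
qed (use kronecker_2_left_pos assms in auto)

lemma kronecker_2_right: "odd m \<Longrightarrow> m > 0 \<Longrightarrow> kronecker m 2 = kronecker 2 m"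
  by (simp add: kronecker_2_left kronecker_prime_right kronecker_prime_def)

text \<open>The sign attached to negative arguments in the Kronecker symbol makes this hold without any
  positivity assumption.\<close>

lemma kronecker_add_4_mult_right:
  assumes "c \<noteq> 0" "odd a" "coprime c a"
  shows "kronecker c (a + 4 * c) = kronecker c a"
proof -
  \<comment> \<open>The multiple \<open>k\<close> makes the property multiplicative in
    \<open>c\<close>: a shift by 4cc'k is a shift by 4c(c'k) for \<open>c\<close> and by 4c'(ck) for
    \<open>c'\<close>. It then suffices to treat -1, 2 and the odd primes.\<close>
  define P where "P = (\<lambda>c. \<forall>a k. odd a \<longrightarrow> coprime c a \<longrightarrow> kronecker c (a + 4 * c * k) = kronecker c a)"
  have odd4: "odd (a + 4 * c * k)" if "odd a" for a c k :: int
    using that by simp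
  have nz: "a + 4 * c * k \<noteq> 0" "a \<noteq> 0" if "odd a" for a c k :: int
    using odd4[OF that, where c = c and k = k] that by (metis even_zero)+
  have mult: "P (c * c')" if "P c" "P c'" "c \<noteq> 0" "c' \<noteq> 0" for c c'
    unfolding P_def
  proof (intro allI impI)
    fix a k assume a: "odd a" "coprime (c * c') a"
    have "kronecker c (a + 4 * c * (c' * k)) = kronecker c a"
         "kronecker c' (a + 4 * c' * (c * k)) = kronecker c' a"
      using that a unfolding P_def by (metis coprime_mult_left_iff)+
    thus "kronecker (c * c') (a + 4 * (c * c') * k) = kronecker (c * c') a"
      using that nz(1)[OF a(1), of "c * c'" k] nz(2)[OF a(1)] by (simp add: kronecker_mult_left mult_ac)
  qed
  have m1: "P (-1)"
  proof -
    have "(a - 4 * k) mod 4 = a mod 4" for a k :: int by presburger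
    thus ?thesis unfolding P_def by (auto simp: kronecker_minus_1_left)
  qed
  have two: "P 2"
  proof -
    have "(a + 8 * k) mod 8 = a mod 8" for a k :: int by simp
    thus ?thesis unfolding P_def by (auto simp: kronecker_2_left)
  qed
  have odd: "P c" if "c > 0" "odd c" for c
    unfolding P_def
  proof (intro allI impI)
    fix a k assume a: "odd a" "coprime c a"
    have cop: "coprime c (a + 4 * c * k)"
      using a(2) gcd_add_mult[of c "4 * k" a] by (simp add: coprime_iff_gcd_eq_1 algebra_simps)
    have "kronecker c (a + 4 * c * k) = kronecker (a + 4 * c * k) c * recip_sign c (a + 4 * c * k)"
      by (rule kronecker_reciprocity) (use that a cop in auto)
    also have "kronecker (a + 4 * c * k) c = kronecker a c"
      by (rule kronecker_cong_left_odd) (use that in \<open>auto simp: cong_iff_dvd_diff\<close>)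
    also have "recip_sign c (a + 4 * c * k) = recip_sign c a"
    proof -
      have "(a + 4 * c * k) mod 4 = a mod 4" by (simp add: mult.assoc)
      thus ?thesis by (simp add: recip_sign_def)
    qed
    also have "kronecker a c * recip_sign c a = kronecker c a"
      by (rule kronecker_reciprocity[symmetric]) (use that a in auto)
    finally show "kronecker c (a + 4 * c * k) = kronecker c a" .
  qed
  have "P c"
    using assms(1)
  proof (induction c rule: prime_divisors_induct)
    case (unit c)
    hence "c = 1 \<or> c = -1" by auto
    thus ?case using m1 odd[of 1] by auto
  next
    case (factor p c)
    have "P p"
    proof (cases "p = 2")
      case False
      hence "p > 2" using factor.hyps odd_prime_gt_2_int by blast
      thus ?thesis using odd[of p] prime_odd_int[of p] factor.hyps by simp
    qed (use two in simp)
    thus ?case using mult[of p c] factor by auto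
  qed auto
  from this[unfolded P_def, rule_format, of a 1] show ?thesis using assms by simp
qed

text \<open>A sign can occur only for negative \<open>a\<close>, when the upper argument turns
  negative. It is the sign by which principal square roots fail to multiply in
  \<open>eta_transforms_lower_iff\<close>.\<close>

lemma kronecker_add_left:
  assumes "odd a"
  shows "kronecker (c + a) a = kronecker c a * (if c \<ge> 0 \<and> c + a < 0 then -1 else 1)"
proof (cases "a > 0")
  case True
  thus ?thesis using kronecker_cong_left_odd[of a "c + a" c] assms
    by (auto simp: cong_iff_dvd_diff)
next
  case False
  hence a: "-a > 0" "odd (-a)" "a \<noteq> 0" using assms by (auto simp: not_less order_le_less)
  have A: "kronecker (c + a) (-a) = kronecker c (-a)"
    by (rule kronecker_cong_left_odd) (use a in \<open>auto simp: cong_iff_dvd_diff\<close>)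
  have B: "kronecker x a = kronecker x (-a) * (if x < 0 then -1 else 1)" for x
    using kronecker_minus_right[of "-a" x] a(3) by simp
  have C: "(if c + a < 0 then -1 else 1) = (if c < 0 then -1 else 1) * (if c \<ge> 0 \<and> c + a < 0 then -1 else 1 :: int)"
    using a(1) by auto
  show ?thesis
    unfolding B[of "c + a"] B[of c] A C by (simp only: mult.assoc)
qed

section \<open>Theta products and the inversion of the eta function\<close>

text \<open>Weierstrass M-test for products: a summable majorant on a disc around each point makes
  the partial products converge locally uniformly.\<close>

lemma holomorphic_on_prodinf_1_plus:
  fixes f :: "nat \<Rightarrow> complex \<Rightarrow> complex"
  assumes "open S" and holo: "\<And>n. f n holomorphic_on S"
    and bound: "\<And>x. x \<in> S \<Longrightarrow> \<exists>d M. d > 0 \<and> cball x d \<subseteq> S \<and> summable M \<and>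
                 (\<forall>n. \<forall>z\<in>cball x d. norm (f n z) \<le> M n)"
  shows "(\<lambda>z. \<Prod>n. 1 + f n z) holomorphic_on S"
proof (rule holomorphic_uniform_sequence[OF \<open>open S\<close>])
  show "(\<lambda>z. \<Prod>n<N. 1 + f n z) holomorphic_on S" for N
    by (intro holomorphic_intros holo)
next
  fix x assume "x \<in> S"
  then obtain d M where dM: "d > 0" "cball x d \<subseteq> S" "summable M"
    "\<And>n z. z \<in> cball x d \<Longrightarrow> norm (f n z) \<le> M n"
    using bound[of x] by blast
  have "uniformly_convergent_on (cball x d) (\<lambda>N z. \<Prod>n<N. 1 + f n z)"
  proof (rule uniformly_convergent_on_prod)
    show "continuous_on (cball x d) (f n)" for n
      using holo dM(2) holomorphic_on_imp_continuous_on holomorphic_on_subset by blast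
    show "uniformly_convergent_on (cball x d) (\<lambda>N z. \<Sum>n<N. norm (f n z))"
      by (rule Weierstrass_m_test'[OF _ dM(3)]) (use dM(4) in auto)
  qed auto
  then obtain g where g: "uniform_limit (cball x d) (\<lambda>N z. \<Prod>n<N. 1 + f n z) g sequentially"
    by (auto simp: uniformly_convergent_on_def)
  have "g z = (\<Prod>n. 1 + f n z)" if z: "z \<in> cball x d" for z
  proof -
    have "(\<lambda>N. \<Prod>n<Suc N. 1 + f n z) \<longlonglongrightarrow> g z"
      using tendsto_uniform_limitI[OF g z] by (subst (asm) filterlim_sequentially_Suc[symmetric])
    moreover have "summable (\<lambda>n. norm (1 + f n z - 1))"
      by (rule summable_comparison_test'[OF dM(3), of 0]) (use dM(4)[OF z] in auto)
    hence "convergent_prod (\<lambda>n. 1 + f n z)"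
      by (intro abs_convergent_prod_imp_convergent_prod summable_imp_abs_convergent_prod)
    hence "(\<lambda>N. \<Prod>n<Suc N. 1 + f n z) \<longlonglongrightarrow> (\<Prod>n. 1 + f n z)"
      unfolding lessThan_Suc_atMost by (rule convergent_prod_LIMSEQ)
    ultimately show ?thesis by (rule LIMSEQ_unique)
  qed
  with g have "uniform_limit (cball x d) (\<lambda>N z. \<Prod>n<N. 1 + f n z) (\<lambda>z. \<Prod>n. 1 + f n z) sequentially"
    by (metis (mono_tags, lifting) uniform_limit_cong')
  thus "\<exists>d. 0 < d \<and> cball x d \<subseteq> S \<and>
    uniform_limit (cball x d) (\<lambda>N z. \<Prod>n<N. 1 + f n z) (\<lambda>z. \<Prod>n. 1 + f n z) sequentially"
    using dM by blast
qed

text \<open>The q-Pochhammer symbol (x; q) with infinitely many factors. Its diagonal x = q gives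
  eta, and two off-diagonal values give theta.\<close>

definition qpoch :: "complex \<Rightarrow> complex \<Rightarrow> complex" where
  "qpoch x q = (\<Prod>n. 1 - x * q ^ n)"

lemma qpoch_convergent:
  fixes x q :: complex
  assumes "norm q < 1"
  shows "convergent_prod (\<lambda>n. 1 - x * q ^ n)"
proof -
  have "summable (\<lambda>n. norm x * norm q ^ n)"
    using assms by (intro summable_mult summable_geometric) auto
  hence "summable (\<lambda>n. norm (1 - x * q ^ n - 1))"
    by (simp add: norm_mult norm_power)
  thus ?thesis
    by (intro abs_convergent_prod_imp_convergent_prod summable_imp_abs_convergent_prod)
qed

lemma qpoch_LIMSEQ:
  assumes "norm q < 1"
  shows "(\<lambda>N. \<Prod>n<N. 1 - x * q ^ n) \<longlonglongrightarrow> qpoch x q"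
  using convergent_prod_LIMSEQ[OF qpoch_convergent[OF assms, of x]]
  unfolding qpoch_def by (simp add: LIMSEQ_lessThan_iff_atMost)

lemma qpoch_eq_0_iff:
  assumes "norm q < 1"
  shows "qpoch x q = 0 \<longleftrightarrow> (\<exists>n. x * q ^ n = 1)"
proof -
  have "(\<lambda>n. 1 - x * q ^ n) has_prod qpoch x q"
    unfolding qpoch_def using qpoch_convergent[OF assms] by blast
  from has_prod_eq_0_iff[OF this] show ?thesis by auto
qed

text \<open>On a closed disc |g| and |h| attain maxima, the former below 1, so a geometric series
  majorises the terms.\<close>

lemma qpoch_holomorphic:
  assumes "open S" "g holomorphic_on S" "h holomorphic_on S" "\<And>z. z \<in> S \<Longrightarrow> norm (g z) < 1"
  shows "(\<lambda>z. qpoch (h z) (g z)) holomorphic_on S"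
proof -
  have "(\<lambda>z. \<Prod>n. 1 + - (h z * g z ^ n)) holomorphic_on S"
  proof (rule holomorphic_on_prodinf_1_plus[OF \<open>open S\<close>])
    show "(\<lambda>z. - (h z * g z ^ n)) holomorphic_on S" for n
      by (intro holomorphic_intros assms)
  next
    fix x assume "x \<in> S"
    then obtain d where d: "d > 0" "cball x d \<subseteq> S"
      using \<open>open S\<close> open_contains_cball by blast
    have cont: "continuous_on (cball x d) (\<lambda>z. norm (g z))" "continuous_on (cball x d) (\<lambda>z. norm (h z))"
      using assms(2,3) d(2) by (auto intro!: continuous_intros holomorphic_on_imp_continuous_on
            intro: holomorphic_on_subset)
    have ne: "cball x d \<noteq> {}" "compact (cball x d)" using d by auto
    obtain u where u: "u \<in> cball x d" "\<And>z. z \<in> cball x d \<Longrightarrow> norm (g z) \<le> norm (g u)"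
      using continuous_attains_sup[OF ne(2,1) cont(1)] by auto
    obtain v where v: "v \<in> cball x d" "\<And>z. z \<in> cball x d \<Longrightarrow> norm (h z) \<le> norm (h v)"
      using continuous_attains_sup[OF ne(2,1) cont(2)] by auto
    have "norm (g u) < 1" using u d assms by blast
    hence "summable (\<lambda>n. norm (h v) * norm (g u) ^ n)"
      by (intro summable_mult summable_geometric) auto
    moreover have "norm (- (h z * g z ^ n)) \<le> norm (h v) * norm (g u) ^ n" if "z \<in> cball x d" for n z
      using u(2)[OF that] v(2)[OF that] by (auto simp: norm_mult norm_power intro!: mult_mono power_mono)
    ultimately show "\<exists>d M. d > 0 \<and> cball x d \<subseteq> S \<and> summable M \<and>
       (\<forall>n. \<forall>z\<in>cball x d. norm (- (h z * g z ^ n)) \<le> M n)"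
      using d by blast
  qed
  thus ?thesis by (simp add: qpoch_def)
qed

lemma qpoch_split_head:
  assumes "norm q < 1"
  shows "qpoch x q = (1 - x) * qpoch (x * q) q"
proof (rule LIMSEQ_unique)
  show "(\<lambda>N. \<Prod>n<Suc N. 1 - x * q ^ n) \<longlonglongrightarrow> qpoch x q"
    using qpoch_LIMSEQ[OF assms, of x] by (subst filterlim_sequentially_Suc)
  have "(\<Prod>n<Suc N. 1 - x * q ^ n) = (1 - x) * (\<Prod>n<N. 1 - x * q * q ^ n)" for N
    by (subst prod.lessThan_Suc_shift) (simp add: mult_ac)
  thus "(\<lambda>N. \<Prod>n<Suc N. 1 - x * q ^ n) \<longlonglongrightarrow> (1 - x) * qpoch (x * q) q"
    using tendsto_mult[OF tendsto_const qpoch_LIMSEQ[OF assms, of "x * q"]] by simp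
qed

lemma qpoch_mult_minus:
  assumes "norm q < 1"
  shows "qpoch x q * qpoch (-x) q = qpoch (x\<^sup>2) (q\<^sup>2)"
proof -
  have "(1 - x * q ^ n) * (1 - (-x) * q ^ n) = 1 - x\<^sup>2 * (q\<^sup>2) ^ n" for n
    by (simp add: algebra_simps power2_eq_square power_mult_distrib)
  thus ?thesis
    using prodinf_mult[OF qpoch_convergent[OF assms, of x] qpoch_convergent[OF assms, of "-x"]]
    unfolding qpoch_def by simp
qed

lemma norm_square_less_1: "norm (q::complex) < 1 \<Longrightarrow> norm (q\<^sup>2) < 1"
  by (simp add: norm_power power_less_one_iff)

lemma qpoch_even_odd:
  assumes "norm q < 1"
  shows "qpoch x q = qpoch x (q\<^sup>2) * qpoch (x * q) (q\<^sup>2)"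
proof (rule LIMSEQ_unique)
  have "strict_mono (\<lambda>n::nat. 2 * n)" by (auto simp: strict_mono_def)
  from LIMSEQ_subseq_LIMSEQ[OF qpoch_LIMSEQ[OF assms, of x] this]
  show "(\<lambda>N. \<Prod>n<2*N. 1 - x * q ^ n) \<longlonglongrightarrow> qpoch x q" by (simp add: o_def)
  have "(\<Prod>n<2*N. 1 - x * q ^ n) = (\<Prod>n<N. 1 - x * (q\<^sup>2) ^ n) * (\<Prod>n<N. 1 - x * q * (q\<^sup>2) ^ n)" for N
    by (induction N) (simp_all add: power_mult[symmetric] mult_ac)
  thus "(\<lambda>N. \<Prod>n<2*N. 1 - x * q ^ n) \<longlonglongrightarrow> qpoch x (q\<^sup>2) * qpoch (x * q) (q\<^sup>2)"
    using tendsto_mult[OF qpoch_LIMSEQ[OF norm_square_less_1[OF assms], of x]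
       qpoch_LIMSEQ[OF norm_square_less_1[OF assms], of "x * q"]] by simp
qed

lemma norm_power_mult_less_1: "norm (q::complex) < 1 \<Longrightarrow> norm (q * q ^ n) < 1"
  by (metis norm_power power_Suc power_less_one_iff norm_ge_zero zero_less_Suc)

lemma qpoch_self_nonzero:
  assumes "norm q < 1"
  shows "qpoch q q \<noteq> 0"
proof -
  have "q * q ^ n \<noteq> 1" for n
    using norm_power_mult_less_1[OF assms, of n] by auto
  thus ?thesis using qpoch_eq_0_iff[OF assms] by blast
qed

text \<open>Euler's identity \<open>\<Prod>(1 + q\<^sup>n) (1 - q\<^sup>2\<^sup>n\<^sup>-\<^sup>1) = 1\<close>, the factor \<open>1 - q\<^sup>2\<^sup>n\<^sup>-\<^sup>1\<close> being split with \<open>s\<^sup>2 = q\<close>.\<close>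

lemma qpoch_half_periods:
  assumes "norm q < 1" "s\<^sup>2 = q"
  shows "qpoch (-q) q * qpoch s q * qpoch (-s) q = 1"
proof -
  have "qpoch q q * (qpoch (-q) q * (qpoch s q * qpoch (-s) q)) =
        (qpoch q q * qpoch (-q) q) * (qpoch s q * qpoch (-s) q)" by simp
  also have "\<dots> = qpoch (q * q) (q\<^sup>2) * qpoch q (q\<^sup>2)"
    using assms by (simp add: qpoch_mult_minus power2_eq_square)
  also have "\<dots> = qpoch q q"
    using qpoch_even_odd[OF assms(1), of q] by simp
  finally show ?thesis
    using qpoch_self_nonzero[OF assms(1)] by (simp add: mult.assoc)
qed

section \<open>Theta functions of rectangular lattices\<close>

text \<open>This is q = exp(2 pi i tau) at tau = iy, the square of the classical nome.\<close>

definition nome :: "real \<Rightarrow> complex" where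
  "nome y = of_real (exp (- (2 * pi * y)))"

lemma norm_nome: "y > 0 \<Longrightarrow> norm (nome y) < 1"
  by (simp add: nome_def)

text \<open>Up to a factor depending on \<open>y\<close> only, this is Jacobi's \<open>\<theta>\<^sub>1\<close> for the lattice \<open>\<int> + \<i>y\<int>\<close>, in product form.\<close>

definition theta :: "real \<Rightarrow> complex \<Rightarrow> complex" where
  "theta y w = sin (of_real pi * w) * qpoch (nome y * exp (2 * of_real pi * \<i> * w)) (nome y)
                 * qpoch (nome y * exp (- (2 * of_real pi * \<i> * w))) (nome y)"

lemma theta_holomorphic: "y > 0 \<Longrightarrow> theta y holomorphic_on UNIV"
  unfolding theta_def [abs_def]
  by (intro holomorphic_intros qpoch_holomorphic) (auto simp: norm_nome)

lemma theta_minus: "theta y (-w) = - theta y w"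
  by (simp add: theta_def)

lemma theta_add_1: "theta y (w + 1) = - theta y w"
proof -
  have e: "exp (2 * of_real pi * \<i> * (w + 1)) = exp (2 * of_real pi * \<i> * w)"
    by (simp add: distrib_left exp_add)
  moreover have "exp (- (2 * of_real pi * \<i> * (w + 1))) = exp (- (2 * of_real pi * \<i> * w))"
    using e by (simp only: exp_minus)
  moreover have "sin (of_real pi * (w + 1)) = - sin (of_real pi * w)"
    by (simp add: algebra_simps sin_add)
  ultimately show ?thesis by (simp add: theta_def)
qed

text \<open>The sine supplies the head factor 1 - exp(2 pi i w) of the first product. In this form a
  shift of \<open>w\<close> by iy is an index shift in both products.\<close>

lemma theta_exp_form:
  assumes "y > 0"
  shows "theta y w = \<i> / 2 * exp (- (of_real pi * \<i> * w)) * qpoch (exp (2 * of_real pi * \<i> * w)) (nome y)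
           * qpoch (nome y * exp (- (2 * of_real pi * \<i> * w))) (nome y)"
proof -
  have "sin (of_real pi * w) = \<i> / 2 * exp (- (of_real pi * \<i> * w)) * (1 - exp (2 * of_real pi * \<i> * w))"
  proof -
    have "exp (2 * of_real pi * \<i> * w) = exp (of_real pi * \<i> * w) * exp (of_real pi * \<i> * w)"
      by (simp add: mult_ac flip: exp_add)
    thus ?thesis
      unfolding sin_exp_eq by (simp add: exp_minus field_simps)
  qed
  thus ?thesis
    using qpoch_split_head[OF norm_nome[OF assms], of "exp (2 * of_real pi * \<i> * w)"]
    by (simp add: theta_def mult_ac)
qed

text \<open>With Z = exp(2 pi i w) the shift sends Z to Zq. The first product loses its head 1 - Z,
  the second gains 1 - 1/Z, and the quotient of these is -1/Z.\<close>

lemma theta_add_period: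
  assumes "y > 0"
  shows "theta y (w + \<i> * of_real y) = - exp (of_real (pi * y) - 2 * of_real pi * \<i> * w) * theta y w"
proof -
  define Z where "Z = exp (2 * of_real pi * \<i> * w)"
  define q where "q = nome y"
  have q: "norm q < 1" "q \<noteq> 0" using norm_nome[OF assms] by (auto simp: q_def nome_def)
  have Z: "Z \<noteq> 0" "exp (- (2 * of_real pi * \<i> * w)) = 1 / Z"
    by (auto simp: Z_def exp_minus field_simps)
  have e1: "exp (2 * of_real pi * \<i> * (w + \<i> * of_real y)) = Z * q"
    unfolding Z_def q_def nome_def
    by (simp add: algebra_simps flip: exp_add exp_of_real)
  have e2: "exp (- (2 * of_real pi * \<i> * (w + \<i> * of_real y))) = 1 / (Z * q)"
    by (simp only: exp_minus e1 inverse_eq_divide)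
  have e3: "exp (- (of_real pi * \<i> * (w + \<i> * of_real y))) = exp (of_real (pi * y)) * exp (- (of_real pi * \<i> * w))"
    by (simp add: algebra_simps flip: exp_add)
  have "theta y (w + \<i> * of_real y) = \<i> / 2 * exp (of_real (pi * y)) * exp (- (of_real pi * \<i> * w))
          * qpoch (Z * q) q * qpoch (1 / Z) q"
    unfolding theta_exp_form[OF assms] e1 e2 e3 using q Z by (simp add: q_def)
  also have "qpoch (1 / Z) q = (1 - 1 / Z) * qpoch (q * (1 / Z)) q"
    using qpoch_split_head[OF q(1), of "1 / Z"] by (simp add: mult_ac)
  also have "\<i> / 2 * exp (of_real (pi * y)) * exp (- (of_real pi * \<i> * w)) * qpoch (Z * q) q *
      ((1 - 1 / Z) * qpoch (q * (1 / Z)) q) = 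
      - exp (of_real (pi * y)) / Z * (\<i> / 2 * exp (- (of_real pi * \<i> * w)) * ((1 - Z) * qpoch (Z * q) q) * qpoch (q * (1 / Z)) q)"
    using Z by (simp add: field_simps)
  also have "(1 - Z) * qpoch (Z * q) q = qpoch Z q"
    using qpoch_split_head[OF q(1), of Z] by simp
  also have "\<i> / 2 * exp (- (of_real pi * \<i> * w)) * qpoch Z q * qpoch (q * (1 / Z)) q = theta y w"
    unfolding theta_exp_form[OF assms] Z(2) by (simp add: Z_def q_def)
  also have "- exp (of_real (pi * y)) / Z = - exp (of_real (pi * y) - 2 * of_real pi * \<i> * w)"
    by (simp add: Z_def exp_diff)
  finally show ?thesis .
qed

lemma theta_eq_0_imp:
  assumes "y > 0" "theta y w = 0"
  obtains m n :: int where "w = of_int m + \<i> * of_real (y * of_int n)"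
proof -
  \<comment> \<open>The sign \<sigma> handles both infinite products at once; their zeros are the
    lattice points below (\<sigma> = 1) and above (\<sigma> = -1) the real axis.\<close>
  have *: "\<exists>m n::int. w = of_int m + \<i> * of_real (y * of_int n)"
    if "exp (\<sigma> * (2 * of_real pi * \<i> * w)) * nome y ^ Suc k = 1" "\<sigma> = 1 \<or> \<sigma> = -1" for \<sigma> k
  proof -
    have "nome y ^ Suc k = exp (of_real (- (2 * pi * y * real (Suc k))))"
      unfolding nome_def exp_of_real[symmetric] exp_of_nat_mult[symmetric]
      by (simp add: mult_ac)
    hence "exp (\<sigma> * (2 * of_real pi * \<i> * w) + of_real (- (2 * pi * y * real (Suc k)))) = 1"
      using that(1) by (simp only: exp_add)
    then obtain m :: int where m: "Re (\<sigma> * (2 * of_real pi * \<i> * w)) = 2 * pi * y * real (Suc k)"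
      "Im (\<sigma> * (2 * of_real pi * \<i> * w)) = of_int (2 * m) * pi"
      unfolding exp_eq_1 by (auto simp del: of_nat_Suc)
    from that(2) show ?thesis
    proof
      assume s: "\<sigma> = 1"
      have "pi * Im w = pi * (- (y * real (Suc k)))" "pi * Re w = pi * of_int m"
        using m s by (simp_all add: algebra_simps)
      hence "w = of_int m + \<i> * of_real (y * of_int (- int (Suc k)))"
        unfolding mult_cancel_left by (simp add: complex_eq_iff algebra_simps)
      thus ?thesis by blast
    next
      assume s: "\<sigma> = -1"
      have "pi * Im w = pi * (y * real (Suc k))" "pi * Re w = pi * of_int (-m)"
        using m s by (simp_all add: algebra_simps)
      hence "w = of_int (-m) + \<i> * of_real (y * of_int (int (Suc k)))"
        unfolding mult_cancel_left by (simp add: complex_eq_iff algebra_simps)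
      thus ?thesis by blast
    qed
  qed
  have q: "norm (nome y) < 1" using norm_nome assms by blast
  have "sin (of_real pi * w) = 0 \<or> qpoch (nome y * exp (2 * of_real pi * \<i> * w)) (nome y) = 0 \<or>
        qpoch (nome y * exp (- (2 * of_real pi * \<i> * w))) (nome y) = 0"
    using assms(2) by (auto simp: theta_def)
  hence "\<exists>m n::int. w = of_int m + \<i> * of_real (y * of_int n)"
  proof (elim disjE)
    assume "sin (of_real pi * w) = 0"
    then obtain m :: int where "of_real pi * w = of_real (of_int m * pi)"
      by (auto simp: sin_eq_0)
    hence "w = of_int m + \<i> * of_real (y * of_int 0)" by simp
    thus ?thesis by blast
  next
    assume "qpoch (nome y * exp (2 * of_real pi * \<i> * w)) (nome y) = 0"
    then obtain k where "nome y * exp (2 * of_real pi * \<i> * w) * nome y ^ k = 1"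
      using qpoch_eq_0_iff[OF q] by blast
    thus ?thesis using *[of 1 k] by (simp add: mult_ac)
  next
    assume "qpoch (nome y * exp (- (2 * of_real pi * \<i> * w))) (nome y) = 0"
    then obtain k where "nome y * exp (- (2 * of_real pi * \<i> * w)) * nome y ^ k = 1"
      using qpoch_eq_0_iff[OF q] by blast
    thus ?thesis using *[of "-1" k] by (simp add: mult_ac)
  qed
  thus ?thesis using that by blast
qed

text \<open>The sine has a simple zero at 0, so the derivative is pi times the cofactor at 0. This
  is how the product for eta enters the constant of proportionality.\<close>

lemma theta_deriv_0:
  assumes "y > 0"
  shows "(theta y has_field_derivative of_real pi * (qpoch (nome y) (nome y))\<^sup>2) (at 0)"
proof -
  define H where "H = (\<lambda>w. qpoch (nome y * exp (2 * of_real pi * \<i> * w)) (nome y)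
                 * qpoch (nome y * exp (- (2 * of_real pi * \<i> * w))) (nome y))"
  have "H holomorphic_on UNIV" unfolding H_def
    by (intro holomorphic_intros qpoch_holomorphic) (use norm_nome[OF assms] in auto)
  then obtain H' where H': "(H has_field_derivative H') (at 0)"
    by (meson UNIV_I field_differentiable_def holomorphic_on_imp_differentiable_at open_UNIV)
  have "((\<lambda>w. sin (of_real pi * w) * H w) has_field_derivative of_real pi * H 0) (at 0)"
    by (rule derivative_eq_intros H' refl)+ simp
  thus ?thesis
    by (simp add: H_def theta_def[abs_def] power2_eq_square mult_ac)
qed

text \<open>The quotient of the two functions is doubly periodic, and its singularity at 0 is removable;
  Liouville's theorem applies.\<close>

lemma quasi_periodic_proportional:
  fixes f g u :: "complex \<Rightarrow> complex" and y :: real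
  assumes y: "y > 0" and f: "f holomorphic_on UNIV" and g: "g holomorphic_on UNIV"
    and f1: "\<And>w. f (w + 1) = - f w" and g1: "\<And>w. g (w + 1) = - g w"
    and fy: "\<And>w. f (w + \<i> * of_real y) = u w * f w" and gy: "\<And>w. g (w + \<i> * of_real y) = u w * g w"
    and u: "\<And>w. u w \<noteq> 0"
    and zero: "\<And>w. g w = 0 \<Longrightarrow> \<bar>Re w\<bar> < 1 \<Longrightarrow> \<bar>Im w\<bar> < y \<Longrightarrow> w = 0"
    and f0: "f 0 = 0" and g0: "g 0 = 0"
    and df: "(f has_field_derivative f') (at 0)" and dg: "(g has_field_derivative g') (at 0)"
    and "g' \<noteq> 0"
  shows "g w \<noteq> 0 \<Longrightarrow> f w = f' / g' * g w"
proof -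
  \<comment> \<open>The value f'/g' is the limit of f/g at 0. It is imposed at every zero of
    \<open>g\<close>, which keeps F periodic at all points.\<close>
  define F where "F = (\<lambda>w. if g w = 0 then f' / g' else f w / g w)"
  have per1: "F (w + 1) = F w" for w by (simp add: F_def f1 g1)
  have pery: "F (w + \<i> * of_real y) = F w" for w by (simp add: F_def fy gy u)
  have int_period: "F (w + of_int n * p) = F w" if "\<And>w. F (w + p) = F w" for w p n
  proof (induction n rule: int_induct[where k = 0])
    case (step1 i)
    thus ?case using that[of "w + of_int i * p"] by (simp add: algebra_simps)
  next
    case (step2 i)
    thus ?case using that[of "w + of_int (i - 1) * p"] by (simp add: algebra_simps)
  qed simp
  \<comment> \<open>An open neighbourhood of the closed period rectangle R below, small enough that
    0 is the only zero of \<open>g\<close> in it.\<close>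
  define U where "U = {w. \<bar>Re w\<bar> < 1 \<and> \<bar>Im w\<bar> < y}"
  have "open U"
    unfolding U_def by (intro open_Collect_conj open_Collect_less continuous_intros)
  have FU: "F holomorphic_on U"
  proof (rule no_isolated_singularity'[where K = "{0}"])
    have "(\<lambda>w. f w / g w) holomorphic_on U - {0}"
      by (intro holomorphic_intros holomorphic_on_subset[OF f] holomorphic_on_subset[OF g])
         (use zero in \<open>auto simp: U_def\<close>)
    moreover have "F w = f w / g w" if "w \<in> U - {0}" for w
      using that zero[of w] by (auto simp: F_def U_def)
    ultimately show "F holomorphic_on U - {0}" by (metis (no_types, lifting) holomorphic_cong)
    have "0 \<in> U" using y by (auto simp: U_def)
    have "((\<lambda>w. (f w / w) / (g w / w)) \<longlongrightarrow> f' / g') (at 0)"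
      using df dg f0 g0 \<open>g' \<noteq> 0\<close> by (intro tendsto_divide) (auto simp: has_field_derivative_iff)
    moreover have "eventually (\<lambda>w. (f w / w) / (g w / w) = F w) (at 0)"
    proof -
      have "eventually (\<lambda>w. w \<in> U - {0}) (at 0)"
        by (rule eventually_at_in_open[OF \<open>open U\<close> \<open>0 \<in> U\<close>])
      thus ?thesis
        by eventually_elim (use zero in \<open>auto simp: F_def U_def\<close>)
    qed
    ultimately have "(F \<longlongrightarrow> F 0) (at 0)"
      using Lim_transform_eventually by (fastforce simp: F_def g0)
    thus "\<And>z. z \<in> {0} \<Longrightarrow> (F \<longlongrightarrow> F z) (at z within U)"
      using Lim_at_imp_Lim_at_within by blast
  qed (use \<open>open U\<close> in auto)
  define R where "R = cbox (Complex (-1/2) (-y/2)) (Complex (1/2) (y/2))"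
  have RU: "R \<subseteq> U" using y by (auto simp: R_def U_def in_cbox_complex_iff)
  \<comment> \<open>Reduction to R serves twice: it carries differentiability from U to the whole
    plane, and it shows that the range of F is the image of a compact set.\<close>
  have red: "\<exists>l. w + l \<in> R \<and> (\<forall>v. F (v + l) = F v)" for w
  proof -
    define m where "m = - round (Re w)"
    define n where "n = - round (Im w / y)"
    define l where "l = of_int m * 1 + of_int n * (\<i> * of_real y)"
    have "F (v + l) = F v" for v
      unfolding l_def add.assoc[symmetric] using int_period[OF pery] int_period[OF per1] by simp
    moreover have "w + l \<in> R"
    proof -
      have a: "\<bar>of_int (round (Re w)) - Re w\<bar> \<le> 1/2" "\<bar>of_int (round (Im w / y)) - Im w / y\<bar> \<le> 1/2"
        by (rule of_int_round_abs_le)+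
      have "\<bar>of_int (round (Im w / y)) - Im w / y\<bar> * y \<le> 1/2 * y"
        by (intro mult_right_mono a) (use y in auto)
      also have "\<bar>of_int (round (Im w / y)) - Im w / y\<bar> * y = \<bar>(of_int (round (Im w / y)) - Im w / y) * y\<bar>"
        using y by (simp add: abs_mult)
      also have "(of_int (round (Im w / y)) - Im w / y) * y = of_int (round (Im w / y)) * y - Im w"
        using y by (simp add: field_simps)
      finally have "\<bar>Im (w + l)\<bar> \<le> y / 2"
        by (simp add: l_def n_def m_def abs_minus_commute algebra_simps)
      moreover have "\<bar>Re (w + l)\<bar> \<le> 1 / 2"
        using a(1) by (simp add: l_def n_def m_def abs_minus_commute)
      ultimately show ?thesis
        unfolding R_def in_cbox_complex_iff abs_le_iff by simp
    qed
    ultimately show ?thesis by blast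
  qed
  have "F holomorphic_on UNIV"
    unfolding holomorphic_on_def
  proof safe
    fix w
    obtain l where l: "w + l \<in> R" "\<And>v. F (v + l) = F v" using red by blast
    have "F field_differentiable at (w + l)"
      using FU \<open>open U\<close> RU l(1) by (meson holomorphic_on_imp_differentiable_at subsetD)
    then obtain D where "(F has_field_derivative D) (at (w + l))"
      by (auto simp: field_differentiable_def)
    hence "((\<lambda>v. F (v + l)) has_field_derivative D) (at w)"
      by (simp add: DERIV_shift)
    hence "(F has_field_derivative D) (at w)" by (simp add: l(2))
    thus "F field_differentiable at w" by (auto simp: field_differentiable_def)
  qed
  moreover have "bounded (range F)"
  proof (rule bounded_subset)
    have "compact (F ` R)"
      by (intro compact_continuous_image holomorphic_on_imp_continuous_on holomorphic_on_subset[OF FU RU])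
         (auto simp: R_def)
    thus "bounded (F ` R)" by (rule compact_imp_bounded)
    show "range F \<subseteq> F ` R" using red by (metis image_eqI image_subsetI)
  qed
  ultimately have "F constant_on UNIV" by (rule Liouville_theorem)
  hence "F w = F 0" by (auto simp: constant_on_def)
  moreover have "F 0 = f' / g'" by (simp add: F_def g0)
  ultimately have "F w = f' / g'" by simp
  moreover assume "g w \<noteq> 0"
  moreover from this have "F w = f w / g w" by (simp add: F_def)
  ultimately show "f w = f' / g' * g w" by (metis nonzero_divide_eq_eq)
qed


text \<open>At each half period the two products coincide, so theta is an elementary factor times
  the square of \<open>qpoch\<close> at -q, s or -s. By \<open>qpoch_half_periods\<close> these
  multiply to 1, and only the elementary factors remain.\<close>

lemma theta_half_periods:
  assumes "y > 0"
  shows "norm (theta y (1 / 2)) * norm (theta y (\<i> * of_real y / 2)) *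
         norm (theta y (1 / 2 + \<i> * of_real y / 2)) = exp (pi * y) / 4"
proof -
  define q where "q = nome y"
  \<comment> \<open>The square root of q, and the value of exp(2 pi i w) at w = iy/2; the two
    products agree there because q/s = s.\<close>
  define s :: complex where "s = of_real (exp (- (pi * y)))"
  have s: "s\<^sup>2 = q" "s \<noteq> 0"
    by (auto simp: s_def q_def nome_def exp_of_nat_mult[symmetric] simp flip: of_real_power exp_double)
  have q: "norm q < 1" using norm_nome[OF assms] by (simp add: q_def)
  have qs: "q / s = s" using s by (auto simp: power2_eq_square)
  have "theta y (1 / 2) = qpoch (- q) q * qpoch (- q) q"
    by (simp add: theta_def q_def exp_minus flip: sin_of_real)
  hence 1: "norm (theta y (1 / 2)) = norm (qpoch (- q) q) ^ 2"
    by (simp add: norm_mult power2_eq_square)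
  have "exp (2 * of_real pi * \<i> * (\<i> * of_real y / 2)) = s"
    by (simp add: s_def algebra_simps flip: exp_of_real)
  hence "theta y (\<i> * of_real y / 2) =
      \<i> / 2 * exp (- (of_real pi * \<i> * (\<i> * of_real y / 2))) * qpoch s q * qpoch s q"
    unfolding theta_exp_form[OF assms] exp_minus[of "2 * of_real pi * \<i> * _"]
    by (simp only: q_def[symmetric] divide_inverse[symmetric] qs)
  from arg_cong[OF this, of norm]
  have 2: "norm (theta y (\<i> * of_real y / 2)) = exp (pi * y / 2) / 2 * norm (qpoch s q) ^ 2"
    by (simp add: norm_mult norm_divide power2_eq_square)
  have "2 * of_real pi * \<i> * (1 / 2 + \<i> * of_real y / 2) = of_real pi * \<i> + of_real (- (pi * y))"
    by (simp add: algebra_simps)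
  hence "exp (2 * of_real pi * \<i> * (1 / 2 + \<i> * of_real y / 2)) = - s"
    by (simp only: exp_add exp_pi_i s_def exp_of_real mult_minus1)
  hence "theta y (1 / 2 + \<i> * of_real y / 2) =
      \<i> / 2 * exp (- (of_real pi * \<i> * (1 / 2 + \<i> * of_real y / 2))) * qpoch (-s) q * qpoch (-s) q"
    unfolding theta_exp_form[OF assms] exp_minus[of "2 * of_real pi * \<i> * _"]
    by (simp only: q_def[symmetric] divide_inverse[symmetric] divide_minus_right qs)
  from arg_cong[OF this, of norm]
  have 3: "norm (theta y (1 / 2 + \<i> * of_real y / 2)) = exp (pi * y / 2) / 2 * norm (qpoch (-s) q) ^ 2"
    by (simp add: norm_mult norm_divide power2_eq_square)
  have "norm (qpoch (- q) q) ^ 2 * (exp (pi * y / 2) / 2 * norm (qpoch s q) ^ 2) *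
          (exp (pi * y / 2) / 2 * norm (qpoch (-s) q) ^ 2) =
        (exp (pi * y / 2))\<^sup>2 / 4 * (norm (qpoch (- q) q * qpoch s q * qpoch (-s) q))\<^sup>2"
    by (simp add: norm_mult power2_eq_square)
  also have "(exp (pi * y / 2))\<^sup>2 = exp (pi * y)"
    by (simp flip: exp_double)
  also have "qpoch (- q) q * qpoch s q * qpoch (-s) q = 1"
    by (rule qpoch_half_periods[OF q s(1)])
  finally show ?thesis unfolding 1 2 3 by simp
qed

text \<open>The map w -> -iw/y takes the periods 1 and iy to -i/y and 1, so it interchanges the
  simple and the exponential multiplier. The Gaussian factor restores those of
  \<open>theta y\<close>; the constant is the quotient of the derivatives at 0.\<close>

lemma theta_inversion:
  assumes "y > 0" "theta y w \<noteq> 0"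
  shows "exp (- (of_real pi * w\<^sup>2 / of_real y)) * theta (1 / y) (- \<i> * w / of_real y) =
         - \<i> / of_real y * (qpoch (nome (1 / y)) (nome (1 / y)) / qpoch (nome y) (nome y))\<^sup>2 * theta y w"
proof -
  define y' where "y' = 1 / y"
  have y: "y > 0" "y' > 0" "y \<noteq> 0" using assms by (auto simp: y'_def)
  define G where "G = (\<lambda>w. exp (- (of_real pi * w\<^sup>2 * of_real y')) * theta y' (- \<i> * w * of_real y'))"
  define E where "E = (\<lambda>y. qpoch (nome y) (nome y))"
  have E: "E y \<noteq> 0" unfolding E_def by (rule qpoch_self_nonzero[OF norm_nome[OF y(1)]])
  have yy': "complex_of_real y * of_real y' = 1" unfolding y'_def using y(3) by simp
  have "G w = (- \<i> * of_real y' * (of_real pi * (E y')\<^sup>2)) / (of_real pi * (E y)\<^sup>2) * theta y w"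
  proof (rule quasi_periodic_proportional[where f = G and g = "theta y" and w = w and y = y and u = "\<lambda>w. - exp (of_real (pi * y) - 2 * of_real pi * \<i> * w)"])
    show "G holomorphic_on UNIV" unfolding G_def
    proof (intro holomorphic_intros)
      have "(theta y' \<circ> (\<lambda>w. - \<i> * w * of_real y')) holomorphic_on UNIV"
        by (intro holomorphic_on_compose holomorphic_intros holomorphic_on_subset[OF theta_holomorphic[OF y(2)]]) auto
      thus "(\<lambda>w. theta y' (- \<i> * w * of_real y')) holomorphic_on UNIV" by (simp only: o_def)
    qed
    show "theta y holomorphic_on UNIV" by (rule theta_holomorphic[OF y(1)])
    show "G (w + 1) = - G w" for w
    proof -
      have "theta y' (- \<i> * w * of_real y') = theta y' (- \<i> * (w + 1) * of_real y' + \<i> * of_real y')"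
        by (simp add: algebra_simps)
      also have "\<dots> = - exp (of_real (pi * y') - 2 * of_real pi * \<i> * (- \<i> * (w + 1) * of_real y')) *
                  theta y' (- \<i> * (w + 1) * of_real y')"
        by (rule theta_add_period[OF y(2)])
      finally have *: "theta y' (- \<i> * w * of_real y') = - exp (of_real (pi * y') - 2 * of_real pi * \<i> * (- \<i> * (w + 1) * of_real y')) *
                  theta y' (- \<i> * (w + 1) * of_real y')" .
      have e: "exp (- (of_real pi * w\<^sup>2 * of_real y')) * exp (of_real (pi * y') - 2 * of_real pi * \<i> * (- \<i> * (w + 1) * of_real y'))
          = exp (- (of_real pi * (w + 1)\<^sup>2 * of_real y'))"
        unfolding exp_add[symmetric] by (rule arg_cong[where f = exp]) (simp add: algebra_simps power2_eq_square)
      have "G w = - (exp (- (of_real pi * w\<^sup>2 * of_real y')) *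
          exp (of_real (pi * y') - 2 * of_real pi * \<i> * (- \<i> * (w + 1) * of_real y'))) *
          theta y' (- \<i> * (w + 1) * of_real y')"
        unfolding G_def * by (simp only: mult.assoc mult_minus_left mult_minus_right)
      thus ?thesis unfolding e by (simp only: G_def mult_minus_left minus_minus)
    qed
    show "theta y (w + 1) = - theta y w" for w by (rule theta_add_1)
    show "G (w + \<i> * of_real y) = - exp (of_real (pi * y) - 2 * of_real pi * \<i> * w) * G w" for w
    proof -
      have "- \<i> * (w + \<i> * of_real y) * of_real y' = - \<i> * w * of_real y' + 1"
        using yy' by (simp add: algebra_simps)
      hence *: "theta y' (- \<i> * (w + \<i> * of_real y) * of_real y') = - theta y' (- \<i> * w * of_real y')"
        by (simp only: theta_add_1)
      have "(w + \<i> * of_real y)\<^sup>2 * of_real y' = w\<^sup>2 * of_real y' + 2 * \<i> * w - of_real y"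
      proof -
        have "(w + \<i> * of_real y)\<^sup>2 * of_real y' =
            w\<^sup>2 * of_real y' + 2 * \<i> * w * (of_real y * of_real y') - of_real y * (of_real y * of_real y')"
          by (simp add: power2_eq_square algebra_simps)
        thus ?thesis by (simp only: yy' mult_1_right)
      qed
      hence "- (of_real pi * ((w + \<i> * of_real y)\<^sup>2 * of_real y')) =
             (of_real (pi * y) - 2 * of_real pi * \<i> * w) + - (of_real pi * w\<^sup>2 * of_real y')"
        by (simp only:) (simp add: algebra_simps)
      hence "exp (- (of_real pi * (w + \<i> * of_real y)\<^sup>2 * of_real y')) =
             exp (of_real (pi * y) - 2 * of_real pi * \<i> * w) * exp (- (of_real pi * w\<^sup>2 * of_real y'))"
        by (simp only: exp_add mult.assoc)
      thus ?thesis unfolding G_def * by simp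
    qed
    show "theta y (w + \<i> * of_real y) = - exp (of_real (pi * y) - 2 * of_real pi * \<i> * w) * theta y w" for w
      by (rule theta_add_period[OF y(1)])
    show "- exp (of_real (pi * y) - 2 * of_real pi * \<i> * w) \<noteq> 0" for w by simp
    show "w = 0" if w: "theta y w = 0" "\<bar>Re w\<bar> < 1" "\<bar>Im w\<bar> < y" for w
    proof -
      obtain m n :: int where mn: "w = of_int m + \<i> * of_real (y * of_int n)"
        using theta_eq_0_imp[OF y(1) w(1)] .
      have "\<bar>real_of_int m\<bar> < 1" using w(2) mn by simp
      moreover have "y * \<bar>real_of_int n\<bar> < y * 1" using w(3) mn y by (simp add: abs_mult)
      hence "\<bar>real_of_int n\<bar> < 1" using y by (simp only: mult_less_cancel_left_pos)
      ultimately have "m = 0" "n = 0" by linarith+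
      thus ?thesis using mn by simp
    qed
    show "G 0 = 0" "theta y 0 = 0" by (simp_all add: G_def theta_def)
    show "(theta y has_field_derivative of_real pi * (E y)\<^sup>2) (at 0)"
      unfolding E_def by (rule theta_deriv_0[OF y(1)])
    have "(theta y' has_field_derivative of_real pi * (E y')\<^sup>2) (at (- \<i> * 0 * of_real y'))"
      unfolding E_def using theta_deriv_0[OF y(2)] by simp
    hence "((\<lambda>w. theta y' (- \<i> * w * of_real y')) has_field_derivative (of_real pi * (E y')\<^sup>2) * (- \<i> * of_real y')) (at 0)"
      by (rule DERIV_chain2) (auto intro!: derivative_eq_intros)
    moreover have "((\<lambda>w. exp (- (of_real pi * w\<^sup>2 * of_real y'))) has_field_derivative 0) (at 0)"
      by (auto intro!: derivative_eq_intros)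
    ultimately have "(G has_field_derivative 0 * theta y' (- \<i> * 0 * of_real y') +
        (of_real pi * (E y')\<^sup>2) * (- \<i> * of_real y') * exp (- (of_real pi * 0\<^sup>2 * of_real y'))) (at 0)"
      unfolding G_def by (intro DERIV_mult)
    thus "(G has_field_derivative - \<i> * of_real y' * (of_real pi * (E y')\<^sup>2)) (at 0)"
      by (simp add: mult_ac)
    show "of_real pi * (E y)\<^sup>2 \<noteq> 0" using E by simp
    show "theta y w \<noteq> 0" by fact
  qed (use y in auto)
  thus ?thesis by (simp add: G_def E_def y'_def power_divide)
qed

text \<open>The inversion permutes the three half periods up to sign and lattice translation.
  Multiplying its three instances expresses C^3 by two known products, where C = (E(1/y)/E(y))^2 /
  y; hence the sixth powers.\<close>

lemma norm_qpoch_inversion: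
  assumes "y > 0"
  defines "E \<equiv> \<lambda>y. norm (qpoch (nome y) (nome y))"
  shows "E (1 / y) ^ 6 = y ^ 3 * exp (pi * (1 / y - y) / 2) * E y ^ 6"
proof -
  define y' where "y' = 1 / y"
  have y: "y > 0" "y' > 0" "y * y' = 1" using assms by (auto simp: y'_def)
  define C where "C = y' * (E y' / E y)\<^sup>2"
  have E: "E y \<noteq> 0" unfolding E_def using qpoch_self_nonzero[OF norm_nome[OF y(1)]] by simp
  define w1 :: complex where "w1 = 1 / 2"
  define w2 where "w2 = \<i> * of_real y / 2"
  define w3 where "w3 = 1 / 2 + \<i> * of_real y / 2"
  have half: "norm (theta y w1) * norm (theta y w2) * norm (theta y w3) = exp (pi * y) / 4"
    unfolding w1_def w2_def w3_def by (rule theta_half_periods[OF y(1)])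
  hence nz: "theta y w1 \<noteq> 0" "theta y w2 \<noteq> 0" "theta y w3 \<noteq> 0" by auto
  have inv: "exp (- (pi * Re (w\<^sup>2) * y')) * norm (theta y' (- \<i> * w * of_real y')) = C * norm (theta y w)"
    if "theta y w \<noteq> 0" for w
    using arg_cong[OF theta_inversion[OF y(1) that], of norm] y(1)
    by (simp add: y'_def C_def E_def norm_mult norm_divide norm_power)
  have "norm (theta y' (- \<i> * w1 * of_real y')) = norm (theta y' (\<i> * of_real y' / 2))"
    using theta_minus[of y' "\<i> * of_real y' / 2"] by (simp add: w1_def)
  with inv[OF nz(1)] have 1: "exp (- (pi * y' / 4)) * norm (theta y' (\<i> * of_real y' / 2)) = C * norm (theta y w1)"
    by (simp add: w1_def power2_eq_square)
  have "- \<i> * w2 * of_real y' = of_real (y * y') / 2" by (simp add: w2_def)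
  hence "norm (theta y' (- \<i> * w2 * of_real y')) = norm (theta y' (1 / 2))"
    by (simp only: y(3) of_real_1)
  moreover have "- (pi * Re (w2\<^sup>2) * y') = pi * y * (y * y') / 4" by (simp add: w2_def power2_eq_square)
  ultimately have 2: "exp (pi * y / 4) * norm (theta y' (1 / 2)) = C * norm (theta y w2)"
    using inv[OF nz(2)] y(3) by (simp only: mult_1_right)
  have "- \<i> * w3 * of_real y' = of_real (y * y') / 2 - \<i> * of_real y' / 2"
    by (simp add: w3_def algebra_simps)
  also have "\<dots> = - (1 / 2 + \<i> * of_real y' / 2) + 1" using y(3) by simp
  also have "theta y' \<dots> = theta y' (1 / 2 + \<i> * of_real y' / 2)"
    unfolding theta_add_1 theta_minus by simp
  finally have "norm (theta y' (- \<i> * w3 * of_real y')) = norm (theta y' (1 / 2 + \<i> * of_real y' / 2))"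
    by simp
  moreover have "- (pi * Re (w3\<^sup>2) * y') = pi * (y * (y * y') - y') / 4"
    by (simp add: w3_def power2_eq_square algebra_simps)
  ultimately have 3: "exp (pi * (y - y') / 4) * norm (theta y' (1 / 2 + \<i> * of_real y' / 2)) = C * norm (theta y w3)"
    using inv[OF nz(3)] y(3) by (simp only: mult_1_right)
  have "C ^ 3 * (exp (pi * y) / 4) = (C * norm (theta y w1)) * (C * norm (theta y w2)) * (C * norm (theta y w3))"
    unfolding half[symmetric] by (simp add: power3_eq_cube)
  also have "\<dots> = exp (- (pi * y' / 4)) * exp (pi * y / 4) * exp (pi * (y - y') / 4) *
      (norm (theta y' (1 / 2)) * norm (theta y' (\<i> * of_real y' / 2)) * norm (theta y' (1 / 2 + \<i> * of_real y' / 2)))"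
    unfolding 1[symmetric] 2[symmetric] 3[symmetric] by simp
  also have "\<dots> = exp (- (pi * y' / 4)) * exp (pi * y / 4) * exp (pi * (y - y') / 4) * (exp (pi * y') / 4)"
    unfolding theta_half_periods[OF y(2)] ..
  finally have "C ^ 3 = exp (- (pi * y' / 4)) * exp (pi * y / 4) * exp (pi * (y - y') / 4) * exp (pi * y') * exp (- (pi * y))"
    by (simp add: exp_minus field_simps)
  also have "\<dots> = exp (pi * (y' - y) / 2)"
    unfolding exp_add[symmetric] by (rule arg_cong[where f = exp]) (simp add: field_simps)
  finally have C: "C ^ 3 = exp (pi * (y' - y) / 2)" .
  have "E y' ^ 6 = (y * y') ^ 3 * (E y' ^ 6 / E y ^ 6) * E y ^ 6" using E y(3) by simp
  also have "\<dots> = y ^ 3 * C ^ 3 * E y ^ 6"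
    by (simp add: C_def power_mult_distrib power_divide flip: power_mult)
  finally show ?thesis unfolding C by (simp add: y'_def)
qed

text \<open>All partial products are nonnegative reals and these form a closed set. Thus the
  identity for absolute values becomes one for the products themselves.\<close>

lemma qpoch_nome_real:
  assumes "y > 0"
  shows "qpoch (nome y) (nome y) = of_real (norm (qpoch (nome y) (nome y)))"
proof -
  define r where "r = exp (- (2 * pi * y))"
  have r: "0 < r" "r < 1" using assms by (auto simp: r_def)
  have "(\<Prod>n<N. 1 - nome y * nome y ^ n) \<in> \<real>\<^sub>\<ge>\<^sub>0" for N
  proof -
    have "(\<Prod>n<N. 1 - nome y * nome y ^ n) = of_real (\<Prod>n<N. 1 - r * r ^ n)"
      by (simp add: nome_def r_def)
    moreover have "(\<Prod>n<N. 1 - r * r ^ n) \<ge> 0"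
      using r power_le_one[of r "Suc _"] by (intro prod_nonneg) auto
    ultimately show ?thesis by (simp only: nonneg_Reals_of_real_iff)
  qed
  hence "qpoch (nome y) (nome y) \<in> \<real>\<^sub>\<ge>\<^sub>0"
    using Lim_in_closed_set[OF closed_nonneg_Reals_complex _ _ qpoch_LIMSEQ[OF norm_nome[OF assms], of "nome y"]]
    by simp
  thus ?thesis by (auto simp: nonneg_Reals_def)
qed

section \<open>The eta function under translation and inversion\<close>

lemma norm_exp_upper_half_plane: "Im z > 0 \<Longrightarrow> norm (exp (2 * of_real pi * \<i> * z)) < 1"
  by simp

lemma dedekind_eta_qpoch:
  "dedekind_eta z = exp (2 * of_real pi * \<i> * z / 24) *
     qpoch (exp (2 * of_real pi * \<i> * z)) (exp (2 * of_real pi * \<i> * z))"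
  by (simp add: dedekind_eta_def qpoch_def)

lemma dedekind_eta_nonzero: "Im z > 0 \<Longrightarrow> dedekind_eta z \<noteq> 0"
  using qpoch_self_nonzero[OF norm_exp_upper_half_plane[of z]] by (simp add: dedekind_eta_qpoch)

lemma open_upper_half_plane: "open upper_half_plane"
  unfolding upper_half_plane_def by (simp add: open_halfspace_Im_gt)

lemma connected_upper_half_plane: "connected upper_half_plane"
  unfolding upper_half_plane_def by (intro convex_connected convex_halfspace_Im_gt)

lemma dedekind_eta_holomorphic: "dedekind_eta holomorphic_on upper_half_plane"
  unfolding dedekind_eta_qpoch [abs_def]
  by (intro holomorphic_intros qpoch_holomorphic open_upper_half_plane)
     (auto simp: upper_half_plane_def)

lemma dedekind_eta_add_int:
  "dedekind_eta (z + of_int n) = exp (of_real pi * \<i> * of_int n / 12) * dedekind_eta z"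
proof -
  have "exp (2 * of_real pi * \<i> * (z + of_int n)) = exp (2 * of_real pi * \<i> * z)"
    using exp_plus_2pin[of "2 * of_real pi * \<i> * z" n] by (simp add: algebra_simps)
  moreover have "exp (2 * of_real pi * \<i> * (z + of_int n) / 24) =
      exp (of_real pi * \<i> * of_int n / 12) * exp (2 * of_real pi * \<i> * z / 24)"
    unfolding exp_add[symmetric] by (rule arg_cong[where f = exp]) (simp add: field_simps)
  ultimately show ?thesis unfolding dedekind_eta_qpoch by simp
qed

text \<open>On the imaginary axis eta is a nonnegative real, so the identity of sixth powers has a
  unique root; the exponential in \<open>norm_qpoch_inversion\<close> is absorbed by
  q^(1/24).\<close>

lemma dedekind_eta_inversion_imaginary:
  assumes "y > 0"
  shows "dedekind_eta (\<i> * of_real (1 / y)) = of_real (sqrt y) * dedekind_eta (\<i> * of_real y)"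
proof -
  define E where "E = (\<lambda>y. norm (qpoch (nome y) (nome y)))"
  have eta: "dedekind_eta (\<i> * of_real y) = of_real (exp (- (pi * y / 12)) * E y)" if "y > 0" for y
  proof -
    have "exp (2 * of_real pi * \<i> * (\<i> * of_real y)) = nome y"
      by (simp add: nome_def algebra_simps flip: exp_of_real)
    moreover have "exp (2 * of_real pi * \<i> * (\<i> * of_real y) / 24) = of_real (exp (- (pi * y / 12)))"
      by (simp add: algebra_simps flip: exp_of_real)
    ultimately show ?thesis
      unfolding dedekind_eta_qpoch E_def of_real_mult using qpoch_nome_real[OF that] by simp
  qed
  have "exp (- (pi * (1 / y) / 12)) * E (1 / y) = sqrt y * (exp (- (pi * y / 12)) * E y)"
  proof (rule power_eq_imp_eq_base)
    have "(exp (- (pi * (1 / y) / 12)) * E (1 / y)) ^ 6 =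
          exp (- (pi * (1 / y) / 2)) * (y ^ 3 * exp (pi * (1 / y - y) / 2) * E y ^ 6)"
      using norm_qpoch_inversion[OF assms]
      by (simp add: power_mult_distrib E_def flip: exp_of_nat_mult)
    also have "\<dots> = y ^ 3 * (exp (- (pi * (1 / y) / 2)) * exp (pi * (1 / y - y) / 2)) * E y ^ 6"
      by simp
    also have "exp (- (pi * (1 / y) / 2)) * exp (pi * (1 / y - y) / 2) = exp (- (pi * y / 2))"
      unfolding exp_add[symmetric] by (rule arg_cong[where f = exp]) (simp add: field_simps)
    also have "\<dots> = exp (- (pi * y / 12)) ^ 6"
      by (simp flip: exp_of_nat_mult)
    also have "y ^ 3 = sqrt y ^ 6"
      using assms power_mult[of "sqrt y" 2 3] by simp
    finally show "(exp (- (pi * (1 / y) / 12)) * E (1 / y)) ^ 6 = (sqrt y * (exp (- (pi * y / 12)) * E y)) ^ 6"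
      by (simp add: power_mult_distrib)
  qed (use assms in \<open>auto simp: E_def\<close>)
  thus ?thesis
    using eta[of y] eta[of "1 / y"] assms by (simp flip: of_real_mult)
qed

lemma Im_minus_inverse_pos: "Im z > 0 \<Longrightarrow> Im (-1 / z) > 0"
  by (auto simp: Im_divide power2_eq_square intro!: divide_pos_pos add_nonneg_pos)

text \<open>Both sides are holomorphic, the root because -iz stays in the right half plane, and they
  agree on the imaginary axis; the identity theorem does the rest.\<close>

lemma dedekind_eta_inversion:
  assumes "Im z > 0"
  shows "dedekind_eta (-1 / z) = csqrt (- \<i> * z) * dedekind_eta z"
proof -
  define f where "f = (\<lambda>z. dedekind_eta (-1 / z) - csqrt (- \<i> * z) * dedekind_eta z)"
  have "f z = 0"
  proof (rule analytic_continuation[where f = f and w = z and S = upper_half_plane and U = "(\<lambda>y. \<i> * of_real y) ` {0<..}" and \<xi> = \<i>])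
    have "(dedekind_eta \<circ> (\<lambda>z. -1 / z)) holomorphic_on upper_half_plane"
      by (rule holomorphic_on_compose_gen[OF _ dedekind_eta_holomorphic])
         (use Im_minus_inverse_pos in \<open>auto intro!: holomorphic_intros simp: upper_half_plane_def\<close>)
    moreover have "(csqrt \<circ> (\<lambda>z. - \<i> * z)) holomorphic_on upper_half_plane"
      by (rule holomorphic_on_compose_gen[OF _ holomorphic_on_csqrt])
         (auto intro!: holomorphic_intros simp: upper_half_plane_def complex_nonpos_Reals_iff)
    ultimately show "f holomorphic_on upper_half_plane"
      unfolding f_def o_def
      by (intro holomorphic_on_diff holomorphic_on_mult dedekind_eta_holomorphic)
    show "\<i> islimpt (\<lambda>y. \<i> * of_real y) ` {0<..}"
    proof (subst islimpt_sequential, intro exI conjI allI)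
      show "\<i> * of_real (1 + 1 / real (Suc n)) \<in> (\<lambda>y. \<i> * of_real y) ` {0<..} - {\<i>}" for n
        by (auto intro!: imageI add_pos_pos simp: complex_eq_iff)
      have "(\<lambda>n. 1 + inverse (real (Suc n))) \<longlonglongrightarrow> 1 + 0"
        by (intro tendsto_intros LIMSEQ_inverse_real_of_nat)
      hence "(\<lambda>n. \<i> * of_real (1 + 1 / real (Suc n))) \<longlonglongrightarrow> \<i> * of_real 1"
        by (intro tendsto_intros) (simp_all add: inverse_eq_divide)
      thus "(\<lambda>n. \<i> * of_real (1 + 1 / real (Suc n))) \<longlonglongrightarrow> \<i>" by simp
    qed
    show "f w = 0" if w: "w \<in> (\<lambda>y. \<i> * of_real y) ` {0<..}" for w
    proof -
      obtain y where y: "y > 0" "w = \<i> * of_real y" using w by auto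
      have 1: "-1 / w = \<i> * of_real (1 / y)" using y by (simp add: field_simps)
      have "- \<i> * w = of_real y" using y by simp
      hence 2: "csqrt (- \<i> * w) = of_real (sqrt y)" by (simp only: of_real_sqrt[OF less_imp_le[OF y(1)]])
      show ?thesis
        unfolding f_def 1 2 dedekind_eta_inversion_imaginary[OF y(1)]
        unfolding y(2) by (rule diff_self)
    qed
  qed (use assms open_upper_half_plane connected_upper_half_plane in \<open>auto simp: upper_half_plane_def\<close>)
  thus ?thesis by (simp add: f_def)
qed

section \<open>Branches of the square root\<close>

lemma csqrt_upper:
  assumes "Im u > 0"
  shows "Re (csqrt u) > 0" "Im (csqrt u) > 0"
proof -
  define x where "x = csqrt u"
  have "Im (x\<^sup>2) > 0" using assms by (simp add: x_def)
  hence "Re x * Im x > 0" by (simp add: power2_eq_square mult.commute)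
  moreover have "0 < Re x \<or> Re x = 0 \<and> 0 \<le> Im x" unfolding x_def by (rule csqrt_principal)
  ultimately show "Re (csqrt u) > 0" "Im (csqrt u) > 0"
    unfolding x_def[symmetric] by (auto simp: zero_less_mult_iff)
qed

lemma csqrt_lower:
  assumes "Im u < 0"
  shows "Re (csqrt u) > 0" "Im (csqrt u) < 0"
proof -
  define x where "x = csqrt u"
  have "Im (x\<^sup>2) < 0" using assms by (simp add: x_def)
  hence "Re x * Im x < 0" by (simp add: power2_eq_square mult.commute)
  moreover have "0 < Re x \<or> Re x = 0 \<and> 0 \<le> Im x" unfolding x_def by (rule csqrt_principal)
  ultimately show "Re (csqrt u) > 0" "Im (csqrt u) < 0"
    unfolding x_def[symmetric] by (auto simp: mult_less_0_iff)
qed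

text \<open>With principal arguments, a sign appears iff arg u + arg v exceeds pi. As arg u lies in
  (0, pi), this forces arg v > 0, and then the sum passes pi exactly when uv enters the lower half
  plane.\<close>

lemma csqrt_mult_upper:
  assumes u: "Im u > 0" and v: "v \<noteq> 0"
  shows "csqrt (u * v) =
    (if (Im v > 0 \<or> Im v = 0 \<and> Re v < 0) \<and> Im (u * v) < 0 then -1 else 1) * csqrt u * csqrt v"
proof -
  define \<alpha> \<beta> where "\<alpha> = csqrt u" and "\<beta> = csqrt v"
  have \<alpha>: "Re \<alpha> > 0" "Im \<alpha> > 0" using csqrt_upper[OF u] by (auto simp: \<alpha>_def)
  have sq: "(\<alpha> * \<beta>)\<^sup>2 = u * v" by (simp add: \<alpha>_def \<beta>_def power_mult_distrib)
  show ?thesis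
  proof (cases "Im v > 0 \<or> Im v = 0 \<and> Re v < 0")
    case True
    have \<beta>: "Re \<beta> \<ge> 0" "Im \<beta> > 0"
    proof -
      show "Re \<beta> \<ge> 0" using csqrt_principal[of v] by (auto simp: \<beta>_def)
      show "Im \<beta> > 0"
        using True csqrt_upper(2)[of v] csqrt_of_real_nonpos[of "Re v"]
        by (auto simp: \<beta>_def complex_eq_iff csqrt.simps intro: less_le_trans[OF _ norm_ge_zero])
    qed
    have im: "Im (\<alpha> * \<beta>) > 0" using \<alpha> \<beta> by (simp add: add_pos_nonneg)
    have "Im (u * v) = 2 * (Re (\<alpha> * \<beta>) * Im (\<alpha> * \<beta>))"
      unfolding sq[symmetric] by (simp add: power2_eq_square)
    hence sgn: "Im (u * v) < 0 \<longleftrightarrow> Re (\<alpha> * \<beta>) < 0"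
      using im by (auto simp: mult_less_0_iff simp del: times_complex.sel)
    show ?thesis
    proof (cases "Im (u * v) < 0")
      case neg: True
      have "csqrt (u * v) = - (\<alpha> * \<beta>)"
        by (rule csqrt_unique) (use sq sgn neg in auto)
      thus ?thesis using True neg by (simp add: \<alpha>_def \<beta>_def)
    next
      case False
      have "csqrt (u * v) = \<alpha> * \<beta>"
        by (rule csqrt_unique) (use sq sgn False im in \<open>auto simp del: times_complex.sel\<close>)
      thus ?thesis using False by (simp add: \<alpha>_def \<beta>_def)
    qed
  next
    case False
    have "Re \<beta> > 0" "Im \<beta> \<le> 0"
    proof (atomize (full), cases "Im v < 0")
      case True
      thus "Re \<beta> > 0 \<and> Im \<beta> \<le> 0" using csqrt_lower[of v] by (auto simp: \<beta>_def)
    next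
      case nneg: False
      hence "Im v = 0" "Re v > 0" using False v by (auto simp: complex_eq_iff)
      thus "Re \<beta> > 0 \<and> Im \<beta> \<le> 0" by (simp add: \<beta>_def)
    qed
    hence "Re (\<alpha> * \<beta>) > 0" using \<alpha> by (simp add: mult_nonneg_nonpos less_le_trans[of _ 0] le_less_trans[of _ 0])
    hence "csqrt (u * v) = \<alpha> * \<beta>"
      by (intro csqrt_unique) (use sq in auto)
    thus ?thesis using False by (simp only: \<alpha>_def \<beta>_def simp_thms if_False mult_1_left)
  qed
qed

text \<open>Rotating the upper half plane by -pi/2 does not cross the cut of the root.\<close>

lemma csqrt_minus_ii_mult:
  assumes "Im u > 0"
  shows "csqrt (- \<i> * u) = exp (- (of_real pi * \<i> / 4)) * csqrt u"
proof -
  define x where "x = csqrt u"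
  have x: "Re x > 0" "Im x > 0" using csqrt_upper[OF assms] by (auto simp: x_def)
  have e: "exp (- (of_real pi * \<i> / 4)) = Complex (sqrt 2 / 2) (- (sqrt 2 / 2))"
  proof -
    have "exp (- (of_real pi * \<i> / 4)) = cis (- (pi / 4))"
      by (simp add: cis_conv_exp mult_ac)
    thus ?thesis by (simp add: complex_eq_iff cos_45 sin_45)
  qed
  show ?thesis unfolding x_def[symmetric]
  proof (rule csqrt_unique)
    have "(Complex (sqrt 2 / 2) (- (sqrt 2 / 2)))\<^sup>2 = - \<i>"
      by (simp add: complex_eq_iff power2_eq_square)
    thus "(exp (- (of_real pi * \<i> / 4)) * x)\<^sup>2 = - \<i> * u"
      unfolding e by (simp add: power_mult_distrib x_def)
    have "Re (exp (- (of_real pi * \<i> / 4)) * x) > 0"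
      unfolding e using x by (simp add: add_pos_pos)
    thus "0 < Re (exp (- (of_real pi * \<i> / 4)) * x) \<or>
      Re (exp (- (of_real pi * \<i> / 4)) * x) = 0 \<and> 0 \<le> Im (exp (- (of_real pi * \<i> / 4)) * x)" ..
  qed
qed

text \<open>Writing w/(w+1) = 1 - 1/(w+1) reduces this to a translation, an inversion and another
  translation. The phases combine as 1/12 - 1/4 + 1/12 = -1/12.\<close>

lemma dedekind_eta_lower_unipotent:
  assumes "Im w > 0"
  shows "dedekind_eta (w / (w + 1)) = exp (- (of_real pi * \<i> / 12)) * csqrt (w + 1) * dedekind_eta w"
proof -
  have "w + 1 \<noteq> 0" using assms by (auto simp: complex_eq_iff)
  hence "w / (w + 1) = -1 / (w + 1) + of_int 1" by (simp add: field_simps)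
  hence "dedekind_eta (w / (w + 1)) = exp (of_real pi * \<i> / 12) * dedekind_eta (-1 / (w + 1))"
    using dedekind_eta_add_int[of "-1 / (w + 1)" 1] by simp
  also have "dedekind_eta (-1 / (w + 1)) = csqrt (- \<i> * (w + 1)) * dedekind_eta (w + 1)"
    by (rule dedekind_eta_inversion) (use assms in simp)
  also have "csqrt (- \<i> * (w + 1)) = exp (- (of_real pi * \<i> / 4)) * csqrt (w + 1)"
    by (rule csqrt_minus_ii_mult) (use assms in simp)
  also have "dedekind_eta (w + 1) = exp (of_real pi * \<i> / 12) * dedekind_eta w"
    using dedekind_eta_add_int[of w 1] by simp
  also have "exp (of_real pi * \<i> / 12) * (exp (- (of_real pi * \<i> / 4)) * csqrt (w + 1) *
      (exp (of_real pi * \<i> / 12) * dedekind_eta w)) =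
      (exp (of_real pi * \<i> / 12) * exp (- (of_real pi * \<i> / 4)) * exp (of_real pi * \<i> / 12)) * csqrt (w + 1) * dedekind_eta w"
    by simp
  also have "exp (of_real pi * \<i> / 12) * exp (- (of_real pi * \<i> / 4)) * exp (of_real pi * \<i> / 12) =
             exp (- (of_real pi * \<i> / 12))"
    unfolding exp_add[symmetric] by (rule arg_cong[where f = exp]) simp
  finally show ?thesis .
qed

section \<open>The eta multiplier\<close>

text \<open>The exponent is known modulo 3 from \<open>\<eta>\<^sup>8\<close> (first bracket) and modulo 8 (second bracket); the
  factors 16 and 9 combine the two by the Chinese remainder theorem.\<close>

definition eta_exponent :: "int \<Rightarrow> int \<Rightarrow> int \<Rightarrow> int \<Rightarrow> int" where
  "eta_exponent a b c d = 16 * ((a + d) * c - b * d * (c * c - 1)) + 9 * (a * (b - c + 3) - 3)"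

section \<open>Congruences for the exponent\<close>

lemma exp_24th_cong:
  assumes "[m = n] (mod 24)"
  shows "exp (of_real pi * \<i> * of_int m / 12) = exp (of_real pi * \<i> * of_int n / 12)"
proof -
  obtain k where k: "n = m + 24 * k" using assms by (metis cong_iff_lin)
  have "of_real pi * \<i> * of_int n / 12 = of_real pi * \<i> * of_int m / 12 + \<i> * (of_int k * (of_real pi * 2))"
    by (simp add: k field_simps)
  thus ?thesis by (simp only: exp_plus_2pin)
qed

lemma cong_24_iff:
  fixes m n :: int
  shows "[m = n] (mod 24) \<longleftrightarrow> [m = n] (mod 3) \<and> [m = n] (mod 8)"
  unfolding cong_iff_dvd_diff by presburger

lemma eta_exponent_mod_3:
  "[eta_exponent a b c d = (a + d) * c - b * d * (c * c - 1)] (mod 3)"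
proof -
  have "eta_exponent a b c d - ((a + d) * c - b * d * (c * c - 1)) =
        3 * (5 * ((a + d) * c - b * d * (c * c - 1)) + 3 * (a * (b - c + 3) - 3))"
    by (simp add: eta_exponent_def algebra_simps)
  thus ?thesis unfolding cong_iff_dvd_diff by (metis dvd_triv_left)
qed

lemma eta_exponent_mod_8: "[eta_exponent a b c d = a * (b - c + 3) - 3] (mod 8)"
proof -
  have "eta_exponent a b c d - (a * (b - c + 3) - 3) =
        8 * (2 * ((a + d) * c - b * d * (c * c - 1)) + (a * (b - c + 3) - 3))"
    by (simp add: eta_exponent_def algebra_simps)
  thus ?thesis unfolding cong_iff_dvd_diff by (metis dvd_triv_left)
qed

lemma mod_3_cases: "(x::int) mod 3 \<in> {0, 1, 2}"
  by auto

text \<open>Only residues modulo 3 matter and the determinant condition survives reduction, so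
  finitely many cases decide the congruence.\<close>

lemma cubic_part_lower_mod_3:
  fixes a b c d :: int
  assumes "a * d - b * c = 1"
  shows "[(a + (d + b)) * (c + a) - b * (d + b) * ((c + a) * (c + a) - 1) =
          (a + d) * c - b * d * (c * c - 1) - 1] (mod 3)"
proof -
  define f where "f = (\<lambda>a b c d::int. (a + (d + b)) * (c + a) - b * (d + b) * ((c + a) * (c + a) - 1)
     - ((a + d) * c - b * d * (c * c - 1) - 1))"
  have red: "f (a mod 3) (b mod 3) (c mod 3) (d mod 3) mod 3 = f a b c d mod 3"
    unfolding f_def cong_def[symmetric]
    by (intro cong_diff cong_add cong_mult) (simp_all add: cong_def)
  have det: "(a mod 3 * (d mod 3) - b mod 3 * (c mod 3)) mod 3 = 1"
  proof -
    have "[a mod 3 * (d mod 3) - b mod 3 * (c mod 3) = a * d - b * c] (mod 3)"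
      by (intro cong_diff cong_mult) (simp_all add: cong_def)
    thus ?thesis using assms by (simp add: cong_def)
  qed
  have "\<forall>a\<in>{0,1,2}. \<forall>b\<in>{0,1,2}. \<forall>c\<in>{0,1,2}. \<forall>d\<in>{0,1,2}. 
      (a * d - b * c) mod 3 = 1 \<longrightarrow> f a b c d mod 3 = 0"
    unfolding f_def by simp
  from this[rule_format, OF mod_3_cases mod_3_cases mod_3_cases mod_3_cases det]
  have "f a b c d mod 3 = 0" unfolding red .
  thus ?thesis unfolding f_def by (simp add: cong_iff_dvd_diff mod_eq_0_iff_dvd)
qed

lemma cubic_part_upper_mod_3:
  fixes a b c d :: int
  assumes "a * d - b * c = 1"
  shows "[(a + 4 * c + d) * c - (b + 4 * d) * d * (c * c - 1) =
          (a + d) * c - b * d * (c * c - 1) + 4] (mod 3)"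
proof -
  define f where "f = (\<lambda>a b c d::int. (a + 4 * c + d) * c - (b + 4 * d) * d * (c * c - 1)
     - ((a + d) * c - b * d * (c * c - 1) + 4))"
  have red: "f (a mod 3) (b mod 3) (c mod 3) (d mod 3) mod 3 = f a b c d mod 3"
    unfolding f_def cong_def[symmetric]
    by (intro cong_diff cong_add cong_mult) (simp_all add: cong_def)
  have det: "(a mod 3 * (d mod 3) - b mod 3 * (c mod 3)) mod 3 = 1"
  proof -
    have "[a mod 3 * (d mod 3) - b mod 3 * (c mod 3) = a * d - b * c] (mod 3)"
      by (intro cong_diff cong_mult) (simp_all add: cong_def)
    thus ?thesis using assms by (simp add: cong_def)
  qed
  have "\<forall>a\<in>{0,1,2}. \<forall>b\<in>{0,1,2}. \<forall>c\<in>{0,1,2}. \<forall>d\<in>{0,1,2}. 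
      (a * d - b * c) mod 3 = 1 \<longrightarrow> f a b c d mod 3 = 0"
    unfolding f_def by simp
  from this[rule_format, OF mod_3_cases mod_3_cases mod_3_cases mod_3_cases det]
  have "f a b c d mod 3 = 0" unfolding red .
  thus ?thesis unfolding f_def by (simp add: cong_iff_dvd_diff mod_eq_0_iff_dvd)
qed

text \<open>The -1 mirrors the phase in \<open>dedekind_eta_lower_unipotent\<close>. Modulo 8 the
  exponent changes by -a^2, which is -1 for odd \<open>a\<close>.\<close>

lemma eta_exponent_lower:
  assumes "odd a" "a * d - b * c = 1"
  shows "[eta_exponent a b (c + a) (d + b) = eta_exponent a b c d - 1] (mod 24)"
  unfolding cong_24_iff
proof
  have "[eta_exponent a b (c + a) (d + b) = 
      (a + (d + b)) * (c + a) - b * (d + b) * ((c + a) * (c + a) - 1)] (mod 3)"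
    by (rule eta_exponent_mod_3)
  also have "[(a + (d + b)) * (c + a) - b * (d + b) * ((c + a) * (c + a) - 1) =
      (a + d) * c - b * d * (c * c - 1) - 1] (mod 3)"
    by (rule cubic_part_lower_mod_3[OF assms(2)])
  also have "[(a + d) * c - b * d * (c * c - 1) - 1 = eta_exponent a b c d - 1] (mod 3)"
    by (intro cong_diff cong_refl cong_sym[OF eta_exponent_mod_3])
  finally show "[eta_exponent a b (c + a) (d + b) = eta_exponent a b c d - 1] (mod 3)" .
  have "[eta_exponent a b (c + a) (d + b) = a * (b - (c + a) + 3) - 3] (mod 8)"
    by (rule eta_exponent_mod_8)
  also have "[a * (b - (c + a) + 3) - 3 = (a * (b - c + 3) - 3) - 1] (mod 8)"
  proof -
    obtain k where k: "a = 2 * k + 1" using assms(1) by (elim oddE)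
    have "even (k * (k + 1))" by simp
    then obtain l where "k * (k + 1) = 2 * l" by (elim evenE)
    hence "a * (b - (c + a) + 3) - 3 - ((a * (b - c + 3) - 3) - 1) = 8 * (- l)"
      unfolding k by (simp add: algebra_simps)
    thus ?thesis unfolding cong_iff_dvd_diff by (metis dvd_triv_left)
  qed
  also have "[(a * (b - c + 3) - 3) - 1 = eta_exponent a b c d - 1] (mod 8)"
    by (intro cong_diff cong_refl cong_sym[OF eta_exponent_mod_8])
  finally show "[eta_exponent a b (c + a) (d + b) = eta_exponent a b c d - 1] (mod 8)" .
qed

text \<open>The 4 is the phase of the translation by 4. Modulo 8 the change is 4(ad - bc) up to
  multiples of 8, because c(3 - c) is even.\<close>

lemma eta_exponent_upper:
  assumes "a * d - b * c = 1"
  shows "[eta_exponent (a + 4 * c) (b + 4 * d) c d = eta_exponent a b c d + 4] (mod 24)"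
  unfolding cong_24_iff
proof
  have "[eta_exponent (a + 4 * c) (b + 4 * d) c d = 
      (a + 4 * c + d) * c - (b + 4 * d) * d * (c * c - 1)] (mod 3)"
    by (rule eta_exponent_mod_3)
  also have "[(a + 4 * c + d) * c - (b + 4 * d) * d * (c * c - 1) =
      (a + d) * c - b * d * (c * c - 1) + 4] (mod 3)"
    by (rule cubic_part_upper_mod_3[OF assms])
  also have "[(a + d) * c - b * d * (c * c - 1) + 4 = eta_exponent a b c d + 4] (mod 3)"
    by (intro cong_add cong_refl cong_sym[OF eta_exponent_mod_3])
  finally show "[eta_exponent (a + 4 * c) (b + 4 * d) c d = eta_exponent a b c d + 4] (mod 3)" .
  have "[eta_exponent (a + 4 * c) (b + 4 * d) c d = (a + 4 * c) * (b + 4 * d - c + 3) - 3] (mod 8)"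
    by (rule eta_exponent_mod_8)
  also have "[(a + 4 * c) * (b + 4 * d - c + 3) - 3 = (a * (b - c + 3) - 3) + 4] (mod 8)"
  proof -
    have "even (c * (3 - c))" by simp
    then obtain l where l: "c * (3 - c) = 2 * l" by (elim evenE)
    have "(a + 4 * c) * (b + 4 * d - c + 3) - 3 - ((a * (b - c + 3) - 3) + 4) =
          4 * (a * d - b * c) - 4 + 8 * (b * c) + 16 * (c * d) + 4 * (c * (3 - c))"
      by (simp add: algebra_simps)
    also have "\<dots> = 8 * (b * c + 2 * (c * d) + l)"
      unfolding l assms by simp
    finally show ?thesis unfolding cong_iff_dvd_diff by (metis dvd_triv_left)
  qed
  also have "[(a * (b - c + 3) - 3) + 4 = eta_exponent a b c d + 4] (mod 8)"
    by (intro cong_add cong_refl cong_sym[OF eta_exponent_mod_8])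
  finally show "[eta_exponent (a + 4 * c) (b + 4 * d) c d = eta_exponent a b c d + 4] (mod 8)" .
qed

section \<open>The transformation law for odd \<open>a\<close>\<close>

lemma automorphy_nonzero:
  assumes "a * d - b * c = (1::int)" "Im z > 0"
  shows "of_int c * z + of_int d \<noteq> 0"
proof
  assume *: "of_int c * z + of_int d = 0"
  have "Im (of_int c * z + of_int d) = 0" unfolding * by simp
  hence "c = 0" using assms(2) by simp
  thus False using * assms(1) by auto
qed

lemma Im_moebius_pos:
  assumes "a * d - b * c = (1::int)" "Im z > 0"
  shows "Im ((of_int a * z + of_int b) / (of_int c * z + of_int d)) > 0"
proof -
  define v where "v = of_int c * z + of_int d"
  have v: "v \<noteq> 0" unfolding v_def by (rule automorphy_nonzero[OF assms])
  have "Im ((of_int a * z + of_int b) * cnj v) = of_int (a * d - b * c) * Im z"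
    by (simp add: v_def algebra_simps)
  hence "Im ((of_int a * z + of_int b) * cnj v) = Im z" by (simp add: assms)
  moreover have "(of_int a * z + of_int b) / v = (of_int a * z + of_int b) * cnj v / of_real ((norm v)\<^sup>2)"
    by (rule complex_div_cnj)
  ultimately show ?thesis using assms(2) v unfolding v_def[symmetric] by simp
qed

text \<open>The root is principal for all signs of \<open>c\<close> and \<open>d\<close>; A and -A,
  which act alike on z, are covered as separate cases, since the descent may pass through
  either.\<close>

definition eta_transforms :: "int \<Rightarrow> int \<Rightarrow> int \<Rightarrow> int \<Rightarrow> bool" where
  "eta_transforms a b c d \<longleftrightarrow> (\<forall>z. Im z > 0 \<longrightarrow>
     dedekind_eta ((of_int a * z + of_int b) / (of_int c * z + of_int d)) =
     of_int (kronecker c a) * exp (of_real pi * \<i> * of_int (eta_exponent a b c d) / 12) *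
     csqrt (of_int c * z + of_int d) * dedekind_eta z)"

text \<open>The sign \<open>s\<close> arises twice, from the product of the roots and from the
  symbol (\<open>kronecker_add_left\<close>), and cancels. An equivalence lets the descent move in
  both directions.\<close>

lemma eta_transforms_lower_iff:
  assumes "odd a" "a * d - b * c = 1"
  shows "eta_transforms a b (c + a) (d + b) \<longleftrightarrow> eta_transforms a b c d"
  unfolding eta_transforms_def
proof (intro all_cong1 imp_cong refl)
  fix z :: complex assume z: "Im z > 0"
  define v where "v = of_int c * z + of_int d"
  define w where "w = (of_int a * z + of_int b) / v"
  define s :: int where "s = (if c \<ge> 0 \<and> c + a < 0 then -1 else 1)"
  have v: "v \<noteq> 0" unfolding v_def by (rule automorphy_nonzero[OF assms(2) z])
  have w: "Im w > 0" unfolding w_def v_def by (rule Im_moebius_pos[OF assms(2) z])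
  have wv: "(w + 1) * v = of_int (c + a) * z + of_int (d + b)"
    using v by (simp add: w_def field_simps) (simp add: v_def algebra_simps)
  have w1: "w + 1 \<noteq> 0" using w by (auto simp: complex_eq_iff)
  hence nz: "csqrt (w + 1) \<noteq> 0" by simp
  have "csqrt ((w + 1) * v) = of_int s * csqrt (w + 1) * csqrt v"
  proof -
    have "(Im v > 0 \<or> Im v = 0 \<and> Re v < 0) \<longleftrightarrow> c > 0 \<or> c = 0 \<and> d < 0"
      using z by (auto simp: v_def zero_less_mult_iff)
    moreover have "Im ((w + 1) * v) < 0 \<longleftrightarrow> c + a < 0"
      unfolding wv using z by (auto simp: mult_less_0_iff simp flip: of_int_add)
    \<comment> \<open>For c = 0 the determinant gives ad = 1, so \<open>a\<close> and
      \<open>d\<close> have the same sign.\<close>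
    moreover have "(c > 0 \<or> c = 0 \<and> d < 0) \<and> c + a < 0 \<longleftrightarrow> c \<ge> 0 \<and> c + a < 0"
      using assms(2) by (cases "c = 0") (auto simp: zmult_eq_1_iff)
    ultimately show ?thesis
      using csqrt_mult_upper[of "w + 1" v] w v by (simp add: s_def)
  qed
  hence sqrt: "csqrt (of_int (c + a) * z + of_int (d + b)) = of_int s * csqrt (w + 1) * csqrt v"
    by (simp only: wv)
  have kron: "kronecker (c + a) a = kronecker c a * s"
    unfolding s_def by (rule kronecker_add_left[OF assms(1)])
  have ss: "of_int s * of_int s = (1 :: complex)" by (simp add: s_def)
  have "exp (of_real pi * \<i> * of_int (eta_exponent a b (c + a) (d + b)) / 12) =
        exp (of_real pi * \<i> * of_int (eta_exponent a b c d - 1) / 12)"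
    by (rule exp_24th_cong[OF eta_exponent_lower[OF assms]])
  also have "of_real pi * \<i> * of_int (eta_exponent a b c d - 1) / 12 =
             - (of_real pi * \<i> / 12) + of_real pi * \<i> * of_int (eta_exponent a b c d) / 12"
    by (simp add: field_simps)
  finally have ex: "exp (of_real pi * \<i> * of_int (eta_exponent a b (c + a) (d + b)) / 12) =
      exp (- (of_real pi * \<i> / 12)) * exp (of_real pi * \<i> * of_int (eta_exponent a b c d) / 12)"
    by (simp only: exp_add)
  have "(of_int a * z + of_int b) / (of_int (c + a) * z + of_int (d + b)) = w / (w + 1)"
    unfolding wv[symmetric] using v w1 by (simp add: w_def)
  hence lhs: "dedekind_eta ((of_int a * z + of_int b) / (of_int (c + a) * z + of_int (d + b))) =
     exp (- (of_real pi * \<i> / 12)) * csqrt (w + 1) * dedekind_eta w"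
    using dedekind_eta_lower_unipotent[OF w] by simp
  have rhs: "of_int (kronecker (c + a) a) * exp (of_real pi * \<i> * of_int (eta_exponent a b (c + a) (d + b)) / 12) *
     csqrt (of_int (c + a) * z + of_int (d + b)) * dedekind_eta z =
     exp (- (of_real pi * \<i> / 12)) * csqrt (w + 1) * (of_int (kronecker c a) *
       exp (of_real pi * \<i> * of_int (eta_exponent a b c d) / 12) * csqrt v * dedekind_eta z)"
    unfolding ex sqrt kron using ss by (simp add: mult_ac)
  show "(dedekind_eta ((of_int a * z + of_int b) / (of_int (c + a) * z + of_int (d + b))) =
      of_int (kronecker (c + a) a) * exp (of_real pi * \<i> * of_int (eta_exponent a b (c + a) (d + b)) / 12) *
      csqrt (of_int (c + a) * z + of_int (d + b)) * dedekind_eta z) =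
     (dedekind_eta ((of_int a * z + of_int b) / (of_int c * z + of_int d)) =
      of_int (kronecker c a) * exp (of_real pi * \<i> * of_int (eta_exponent a b c d) / 12) *
      csqrt (of_int c * z + of_int d) * dedekind_eta z)"
    unfolding lhs rhs v_def[symmetric] w_def[symmetric] using nz by simp
qed

text \<open>The bottom row, hence the root, is unchanged; the symbol is unchanged by
  \<open>kronecker_add_4_mult_right\<close>, and the phases agree.\<close>

lemma eta_transforms_upper_iff:
  assumes "odd a" "a * d - b * c = 1"
  shows "eta_transforms (a + 4 * c) (b + 4 * d) c d \<longleftrightarrow> eta_transforms a b c d"
  unfolding eta_transforms_def
proof (intro all_cong1 imp_cong refl)
  fix z :: complex assume z: "Im z > 0"
  define v where "v = of_int c * z + of_int d"
  define w where "w = (of_int a * z + of_int b) / v"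
  have v: "v \<noteq> 0" unfolding v_def by (rule automorphy_nonzero[OF assms(2) z])
  have "coprime c a"
  proof (rule coprimeI)
    fix e assume "e dvd c" "e dvd a"
    hence "e dvd a * d - b * c" by (intro dvd_diff) auto
    thus "is_unit e" using assms(2) by simp
  qed
  hence kron: "kronecker c (a + 4 * c) = kronecker c a"
    using kronecker_add_4_mult_right[of c a] assms(1) by (cases "c = 0") auto
  have "exp (of_real pi * \<i> * of_int (eta_exponent (a + 4 * c) (b + 4 * d) c d) / 12) =
        exp (of_real pi * \<i> * of_int (eta_exponent a b c d + 4) / 12)"
    by (rule exp_24th_cong[OF eta_exponent_upper[OF assms(2)]])
  also have "of_real pi * \<i> * of_int (eta_exponent a b c d + 4) / 12 =
             of_real pi * \<i> * of_int 4 / 12 + of_real pi * \<i> * of_int (eta_exponent a b c d) / 12"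
    by (simp add: field_simps)
  finally have ex: "exp (of_real pi * \<i> * of_int (eta_exponent (a + 4 * c) (b + 4 * d) c d) / 12) =
      exp (of_real pi * \<i> * of_int 4 / 12) * exp (of_real pi * \<i> * of_int (eta_exponent a b c d) / 12)"
    by (simp only: exp_add)
  have "(of_int (a + 4 * c) * z + of_int (b + 4 * d)) / v = w + of_int 4"
    using v by (simp add: w_def field_simps) (simp add: v_def algebra_simps)
  hence lhs: "dedekind_eta ((of_int (a + 4 * c) * z + of_int (b + 4 * d)) / v) =
     exp (of_real pi * \<i> * of_int 4 / 12) * dedekind_eta w"
    by (simp only: dedekind_eta_add_int)
  show "(dedekind_eta ((of_int (a + 4 * c) * z + of_int (b + 4 * d)) / (of_int c * z + of_int d)) =
      of_int (kronecker c (a + 4 * c)) * exp (of_real pi * \<i> * of_int (eta_exponent (a + 4 * c) (b + 4 * d) c d) / 12) *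
      csqrt (of_int c * z + of_int d) * dedekind_eta z) =
     (dedekind_eta ((of_int a * z + of_int b) / (of_int c * z + of_int d)) =
      of_int (kronecker c a) * exp (of_real pi * \<i> * of_int (eta_exponent a b c d) / 12) *
      csqrt (of_int c * z + of_int d) * dedekind_eta z)"
    unfolding v_def[symmetric] w_def[symmetric] lhs kron ex by (simp add: mult.assoc mult.left_commute[of _ "exp (of_real pi * \<i> * of_int 4 / 12)"])
qed

lemma eta_transforms_translation:
  assumes "a * d = 1"
  shows "eta_transforms a b 0 d"
  unfolding eta_transforms_def
proof (intro allI impI)
  fix z :: complex assume z: "Im z > 0"
  have "a = 1 \<and> d = 1 \<or> a = -1 \<and> d = -1" using assms by (simp add: zmult_eq_1_iff)
  thus "dedekind_eta ((of_int a * z + of_int b) / (of_int 0 * z + of_int d)) =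
     of_int (kronecker 0 a) * exp (of_real pi * \<i> * of_int (eta_exponent a b 0 d) / 12) *
     csqrt (of_int 0 * z + of_int d) * dedekind_eta z"
  proof
    assume ad: "a = 1 \<and> d = 1"
    have "exp (of_real pi * \<i> * of_int (eta_exponent a b 0 d) / 12) = exp (of_real pi * \<i> * of_int b / 12)"
      by (rule exp_24th_cong) (use ad in \<open>simp add: eta_exponent_def cong_iff_dvd_diff\<close>)
    thus ?thesis using ad dedekind_eta_add_int[of z b] by simp
  next
    assume ad: "a = -1 \<and> d = -1"
    \<comment> \<open>The matrix acts as z -> z - b, which explains -b; the -6 contributes exp(-pi
      i/2) = -i and cancels the principal root i of -1.\<close>
    have "exp (of_real pi * \<i> * of_int (eta_exponent a b 0 d) / 12) =
          exp (of_real pi * \<i> * of_int (-b - 6) / 12)"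
    proof (rule exp_24th_cong)
      have "eta_exponent a b 0 d - (-b - 6) = 24 * (- b - 2)"
        using ad by (simp add: eta_exponent_def)
      thus "[eta_exponent a b 0 d = -b - 6] (mod 24)"
        unfolding cong_iff_dvd_diff by (metis dvd_triv_left)
    qed
    also have "of_real pi * \<i> * of_int (-b - 6) / 12 = of_real pi * \<i> * of_int (-b) / 12 - of_real pi / 2 * \<i>"
      by (simp add: field_simps)
    also have "exp \<dots> = exp (of_real pi * \<i> * of_int (-b) / 12) * (- \<i>)"
    proof -
      have "exp (of_real pi / 2 * \<i>) = \<i>" by (simp add: complex_eq_iff Re_exp Im_exp)
      thus ?thesis by (simp add: exp_diff)
    qed
    finally show ?thesis using ad dedekind_eta_add_int[of z "-b"]
      by (simp add: kronecker_minus_1_right algebra_simps)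
  qed
qed

text \<open>If |a| < 2|c|, adding or subtracting \<open>a\<close> lowers |c|; if |a| > 2|c|, adding
  or subtracting 4c lowers |a|. The signs of \<open>a\<close> and \<open>c\<close> select the
  direction, and parity excludes equality.\<close>

theorem eta_transforms_odd:
  assumes "odd a" "a * d - b * c = 1"
  shows "eta_transforms a b c d"
  using assms
proof (induction "nat (\<bar>a\<bar> + \<bar>c\<bar>)" arbitrary: a b c d rule: less_induct)
  case less
  show ?case
  proof (cases "c = 0")
    case True
    thus ?thesis using eta_transforms_translation less.prems by simp
  next
    case c: False
    have a: "a \<noteq> 0" using less.prems(1) by auto
    have a2: "\<bar>a\<bar> \<noteq> 2 * \<bar>c\<bar>"
      using less.prems(1) by (metis dvd_abs_iff dvd_triv_left)
    show ?thesis
    proof (cases "\<bar>a\<bar> < 2 * \<bar>c\<bar>")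
      case True
      show ?thesis
      proof (cases "a > 0 \<longleftrightarrow> c > 0")
        case same: True
        have "eta_transforms a b (c - a) (d - b)"
          by (rule less.hyps) (use True same c a less.prems in \<open>auto simp: algebra_simps\<close>)
        thus ?thesis
          using eta_transforms_lower_iff[of a "d - b" b "c - a"] less.prems by (simp add: algebra_simps)
      next
        case opp: False
        have "eta_transforms a b (c + a) (d + b)"
          by (rule less.hyps) (use True opp c a less.prems in \<open>auto simp: algebra_simps\<close>)
        thus ?thesis
          using eta_transforms_lower_iff[of a d b c] less.prems by simp
      qed
    next
      case False
      show ?thesis
      proof (cases "a > 0 \<longleftrightarrow> c > 0")
        case same: True
        have "eta_transforms (a - 4 * c) (b - 4 * d) c d"
          by (rule less.hyps) (use False same c a a2 less.prems in \<open>auto simp: algebra_simps\<close>)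
        thus ?thesis
          using eta_transforms_upper_iff[of "a - 4 * c" d "b - 4 * d" c] less.prems by (simp add: algebra_simps)
      next
        case opp: False
        have "eta_transforms (a + 4 * c) (b + 4 * d) c d"
          by (rule less.hyps) (use False opp c a a2 less.prems in \<open>auto simp: algebra_simps\<close>)
        thus ?thesis
          using eta_transforms_upper_iff[of a d b c] less.prems by simp
      qed
    qed
  qed
qed

section \<open>Eta quotients\<close>

lemma prod_power_int_sum:
  fixes x :: complex
  assumes "x \<noteq> 0"
  shows "(\<Prod>i\<in>A. x powi f i) = x powi (\<Sum>i\<in>A. f i)"
  by (induction A rule: infinite_finite_induct) (simp_all add: power_int_add assms)

text \<open>With c = c'N the lower left entry c/\<delta> is c'M. Using \<delta>M = N, the exponent
  is linear in M, \<delta> and 1 with coefficients independent of \<delta>: one term for each of the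
  three hypotheses on \<open>r\<close>.\<close>

lemma eta_exponent_divisor:
  assumes "\<delta> * M = N"
  shows "eta_exponent a (\<delta> * b) (c' * M) d =
    (16 * ((a + d) * c' - b * d * c' * c' * N) - 9 * a * c') * M + (16 * b * d + 9 * a * b) * \<delta> + 27 * (a - 1)"
  unfolding eta_exponent_def assms[symmetric] by (simp add: algebra_simps)

lemma eta_quotient_transform_odd:
  assumes "N > 0"
    and sum1: "[(\<Sum>\<delta> | \<delta> dvd N. r \<delta> * int \<delta>) = 0] (mod 24)"
    and sum2: "[(\<Sum>\<delta> | \<delta> dvd N. r \<delta> * int (N div \<delta>)) = 0] (mod 24)"
    and sum0: "(\<Sum>\<delta> | \<delta> dvd N. r \<delta>) = 0"
    and det: "a * d - b * c = 1" and "int N dvd c" and "odd a" and z: "Im z > 0"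
  shows "eta_quotient N r ((of_int a * z + of_int b) / (of_int c * z + of_int d)) =
         eta_character N r a * eta_quotient N r z"
proof -
  obtain c' where c': "c = int N * c'" using \<open>int N dvd c\<close> by blast
  define D where "D = {\<delta>. \<delta> dvd N}"
  define M where "M = (\<lambda>\<delta>. int (N div \<delta>))"
  \<comment> \<open>(c'/a) is common to all \<delta>, as is the root S. Both occur to the total
    power 0, and only the symbols (M/a) survive to form the character.\<close>
  define K :: complex where "K = of_int (kronecker c' a)"
  define S where "S = csqrt (of_int c * z + of_int d)"
  define Q where "Q = (\<lambda>\<delta>. eta_exponent a (int \<delta> * b) (c' * M \<delta>) d)"
  define w where "w = (of_int a * z + of_int b) / (of_int c * z + of_int d)"
  have "a \<noteq> 0" using \<open>odd a\<close> by auto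
  have M: "int \<delta> * M \<delta> = int N" "M \<delta> > 0" "\<delta> > 0" if "\<delta> \<in> D" for \<delta>
    using that \<open>N > 0\<close>
    by (auto simp: D_def M_def dvd_pos_nat div_greater_zero_iff dvd_imp_le simp flip: of_nat_mult)
  have "coprime c' a"
  proof (rule coprimeI)
    fix e assume "e dvd c'" "e dvd a"
    hence "e dvd a * d - b * c" unfolding c' by (intro dvd_diff) auto
    thus "is_unit e" using det by simp
  qed
  hence K: "K \<noteq> 0" using kronecker_values_coprime[of c' a] by (auto simp: K_def)
  have S: "S \<noteq> 0" using automorphy_nonzero[OF det z] by (simp add: S_def)
  have eta: "dedekind_eta (of_nat \<delta> * w) =
      K * of_int (kronecker (M \<delta>) a) * exp (of_real pi * \<i> * of_int (Q \<delta>) / 12) * S * dedekind_eta (of_nat \<delta> * z)"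
    if \<delta>: "\<delta> \<in> D" for \<delta>
  proof -
    have c: "c = int \<delta> * (c' * M \<delta>)" using M(1)[OF \<delta>] by (simp add: c' mult_ac)
    have *: "eta_transforms a (int \<delta> * b) (c' * M \<delta>) d"
      by (rule eta_transforms_odd) (use det c \<open>odd a\<close> in \<open>simp_all add: mult_ac\<close>)
    have im: "Im (of_nat \<delta> * z) > 0" using z M(3)[OF \<delta>] by simp
    have 1: "of_int (c' * M \<delta>) * (of_nat \<delta> * z) + of_int d = of_int c * z + of_int d"
      unfolding c by simp
    have 2: "(of_int a * (of_nat \<delta> * z) + of_int (int \<delta> * b)) / (of_int c * z + of_int d) = of_nat \<delta> * w"
      by (simp add: w_def algebra_simps)
    have 3: "kronecker (c' * M \<delta>) a = kronecker c' a * kronecker (M \<delta>) a"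
      by (rule kronecker_mult_left) (use \<open>a \<noteq> 0\<close> M(2)[OF \<delta>] in auto)
    from *[unfolded eta_transforms_def, rule_format, OF im, unfolded 1 2 3 of_int_mult[of "kronecker _ _"]]
    show ?thesis unfolding Q_def K_def S_def .
  qed
  have "(\<Sum>\<delta>\<in>D. r \<delta> * Q \<delta>) =
      (\<Sum>\<delta>\<in>D. (16 * ((a + d) * c' - b * d * c' * c' * int N) - 9 * a * c') * (r \<delta> * M \<delta>) +
        (16 * b * d + 9 * a * b) * (r \<delta> * int \<delta>) + 27 * (a - 1) * r \<delta>)"
  proof (intro sum.cong refl)
    fix \<delta> assume "\<delta> \<in> D"
    from eta_exponent_divisor[OF M(1)[OF this]]
    show "r \<delta> * Q \<delta> = (16 * ((a + d) * c' - b * d * c' * c' * int N) - 9 * a * c') * (r \<delta> * M \<delta>) +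
        (16 * b * d + 9 * a * b) * (r \<delta> * int \<delta>) + 27 * (a - 1) * r \<delta>"
      unfolding Q_def by (simp only:) (simp add: algebra_simps)
  qed
  also have "\<dots> = (16 * ((a + d) * c' - b * d * c' * c' * int N) - 9 * a * c') * (\<Sum>\<delta>\<in>D. r \<delta> * M \<delta>) +
        (16 * b * d + 9 * a * b) * (\<Sum>\<delta>\<in>D. r \<delta> * int \<delta>) + 27 * (a - 1) * (\<Sum>\<delta>\<in>D. r \<delta>)"
    by (simp only: sum.distrib sum_distrib_left)
  also have "[\<dots> = (16 * ((a + d) * c' - b * d * c' * c' * int N) - 9 * a * c') * 0 +
        (16 * b * d + 9 * a * b) * 0 + 27 * (a - 1) * 0] (mod 24)"
    by (intro cong_add cong_mult cong_refl) (use sum0 sum1 sum2 in \<open>simp_all add: D_def M_def\<close>)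
  finally have "[(\<Sum>\<delta>\<in>D. r \<delta> * Q \<delta>) = 0] (mod 24)" by simp
  from exp_24th_cong[OF this]
  have "exp (of_real pi * \<i> * of_int (\<Sum>\<delta>\<in>D. r \<delta> * Q \<delta>) / 12) = 1" by simp
  also have "of_real pi * \<i> * of_int (\<Sum>\<delta>\<in>D. r \<delta> * Q \<delta>) / 12 =
      (\<Sum>\<delta>\<in>D. of_int (r \<delta>) * (of_real pi * \<i> * of_int (Q \<delta>) / 12))"
    by (simp add: sum_divide_distrib sum_distrib_left mult_ac)
  finally have ex: "(\<Prod>\<delta>\<in>D. exp (of_real pi * \<i> * of_int (Q \<delta>) / 12) powi r \<delta>) = 1"
    using \<open>N > 0\<close> by (simp add: exp_power_int exp_sum D_def)
  have "eta_quotient N r w = (\<Prod>\<delta>\<in>D. (K * of_int (kronecker (M \<delta>) a) *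
      exp (of_real pi * \<i> * of_int (Q \<delta>) / 12) * S * dedekind_eta (of_nat \<delta> * z)) powi r \<delta>)"
    unfolding eta_quotient_def D_def[symmetric] by (intro prod.cong refl) (simp add: eta)
  also have "\<dots> = (\<Prod>\<delta>\<in>D. K powi r \<delta>) * (\<Prod>\<delta>\<in>D. of_int (kronecker (M \<delta>) a) powi r \<delta>) *
      (\<Prod>\<delta>\<in>D. exp (of_real pi * \<i> * of_int (Q \<delta>) / 12) powi r \<delta>) * (\<Prod>\<delta>\<in>D. S powi r \<delta>) *
      (\<Prod>\<delta>\<in>D. dedekind_eta (of_nat \<delta> * z) powi r \<delta>)"
    by (simp only: power_int_mult_distrib prod.distrib)
  also have "(\<Prod>\<delta>\<in>D. K powi r \<delta>) = 1"
    using K sum0 by (simp add: prod_power_int_sum D_def)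
  also have "(\<Prod>\<delta>\<in>D. S powi r \<delta>) = 1"
    using S sum0 by (simp add: prod_power_int_sum D_def)
  finally show ?thesis
    unfolding ex w_def by (simp add: eta_quotient_def eta_character_def D_def M_def)
qed

lemma eta_quotient_nonzero:
  assumes "N > 0" "Im z > 0"
  shows "eta_quotient N r z \<noteq> 0"
proof -
  have "dedekind_eta (of_nat \<delta> * z) \<noteq> 0" if "\<delta> dvd N" for \<delta>
    using that assms by (intro dedekind_eta_nonzero) (auto intro: dvd_pos_nat)
  thus ?thesis using assms by (auto simp: eta_quotient_def)
qed

section \<open>The character and its period\<close>

lemma eta_character_1 [simp]: "eta_character N r 1 = 1"
  by (simp add: eta_character_def)

lemma coprime_cofactor:
  assumes "coprime a (int N)" "\<delta> dvd N"
  shows "coprime (int (N div \<delta>)) a"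
proof -
  have "int (N div \<delta>) dvd int N"
    using assms(2) by (metis dvd_div_mult_self dvd_triv_left of_nat_dvd_iff)
  thus ?thesis using assms(1) by (meson coprime_commute coprime_divisors dvd_refl)
qed

lemma eta_character_values:
  assumes "coprime a (int N)"
  shows "eta_character N r a \<in> {1, -1}"
proof -
  define f where "f = (\<lambda>\<delta>. of_int (kronecker (int (N div \<delta>)) a) powi r \<delta> :: complex)"
  have f: "f \<delta> \<in> {1, -1}" if "\<delta> dvd N" for \<delta>
    using kronecker_values_coprime[OF coprime_cofactor[OF assms that]]
    by (cases "even (r \<delta>)") (auto simp: f_def power_int_minus_left)
  have "(\<Prod>\<delta>\<in>A. f \<delta>) \<in> {1, -1}" if "A \<subseteq> {\<delta>. \<delta> dvd N}" for A
    using that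
  proof (induction A rule: infinite_finite_induct)
    case (insert x A)
    thus ?case using f[of x] by auto
  qed auto
  thus ?thesis by (simp add: eta_character_def f_def)
qed

lemma eta_character_mult:
  assumes "coprime a (int N)" "coprime b (int N)"
  shows "eta_character N r (a * b) = eta_character N r a * eta_character N r b"
proof (cases "a = 0 \<or> b = 0")
  case True
  \<comment> \<open>Only for N = 1 is 0 coprime to \<open>N\<close>, and then the sole symbol has
    upper argument 1.\<close>
  hence "N = 1" using assms by auto
  thus ?thesis by (simp add: eta_character_def)
next
  case False
  thus ?thesis
    by (simp add: eta_character_def kronecker_mult_right power_int_mult_distrib prod.distrib)
qed

text \<open>For a' = a + kN, matrices with left columns (a, N) and (a', N) and the same bottom row
  differ by the translation z -> z + k on the left. The quotient is invariant under it and nonzero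
  at the point \<i>, so both matrices have the same character value.\<close>

lemma eta_character_cong_odd:
  assumes "N > 0"
    and sum1: "[(\<Sum>\<delta> | \<delta> dvd N. r \<delta> * int \<delta>) = 0] (mod 24)"
    and sum2: "[(\<Sum>\<delta> | \<delta> dvd N. r \<delta> * int (N div \<delta>)) = 0] (mod 24)"
    and sum0: "(\<Sum>\<delta> | \<delta> dvd N. r \<delta>) = 0"
    and "coprime a (int N)" "[a = a'] (mod int N)" "odd a" "odd a'"
  shows "eta_character N r a = eta_character N r a'"
proof -
  note transform = eta_quotient_transform_odd[OF assms(1-4)]
  obtain k where k: "a' = a + int N * k" using assms(6) by (metis cong_iff_lin)
  obtain d b where "d * a + b * int N = 1"
    using bezout_int[of a "int N"] assms(5) by (auto simp: coprime_iff_gcd_eq_1)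
  hence det: "a * d - (-b) * int N = 1" by (simp add: mult_ac)
  hence det': "a' * d - (-b + k * d) * int N = 1" by (simp add: k algebra_simps)
  have i: "Im \<i> > 0" by simp
  define v where "v = of_int (int N) * \<i> + of_int d"
  define w where "w = (of_int a * \<i> + of_int (-b)) / v"
  have v: "v \<noteq> 0" unfolding v_def by (rule automorphy_nonzero[OF det i])
  have w: "Im w > 0" unfolding w_def v_def by (rule Im_moebius_pos[OF det i])
  have "(of_int a' * \<i> + of_int (-b + k * d)) / v = (of_int 1 * w + of_int k) / (of_int 0 * w + of_int 1)"
    using v by (simp add: w_def field_simps) (simp add: v_def k algebra_simps)
  moreover have "eta_quotient N r ((of_int 1 * w + of_int k) / (of_int 0 * w + of_int 1)) =
      eta_character N r 1 * eta_quotient N r w"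
    by (rule transform) (use w in auto)
  moreover have "eta_quotient N r w = eta_character N r a * eta_quotient N r \<i>"
    unfolding w_def v_def by (rule transform) (use det assms in auto)
  moreover have "eta_quotient N r ((of_int a' * \<i> + of_int (-b + k * d)) / v) =
      eta_character N r a' * eta_quotient N r \<i>"
    unfolding v_def by (rule transform) (use det' assms in auto)
  ultimately show ?thesis
    using eta_quotient_nonzero[OF assms(1) i, of r] by simp
qed

text \<open>For odd \<open>N\<close> the transformation law for odd \<open>a\<close> says nothing about \<open>\<chi>(2)\<close>; quadratic
  reciprocity identifies it with \<open>\<chi>\<close> at an odd number congruent to 2 modulo \<open>N\<close>.\<close>

lemma eta_character_2:
  assumes "odd N"
  shows "eta_character N r 2 = eta_character N r (2 + 3 * int N * int N)"
proof -
  \<comment> \<open>This is 2 modulo each divisor of \<open>N\<close> and 1 modulo 4, since N^2 is 1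
    modulo 4; the reciprocity sign is therefore trivial.\<close>
  define n where "n = 2 + 3 * int N * int N"
  have n4: "n mod 4 = 1"
  proof -
    obtain k where "N = 2 * k + 1" using assms by (elim oddE)
    hence "n = 1 + 4 * (1 + 3 * int k * int k + 3 * int k)" by (simp add: n_def algebra_simps)
    hence "n - 1 = 4 * (1 + 3 * int k * int k + 3 * int k)" by simp
    thus ?thesis by presburger
  qed
  have "kronecker (int (N div \<delta>)) 2 = kronecker (int (N div \<delta>)) n" if "\<delta> dvd N" for \<delta>
  proof -
    define m where "m = int (N div \<delta>)"
    have mN: "int N = m * int \<delta>" using that by (simp add: m_def flip: of_nat_mult)
    have m: "m > 0" "odd m"
    proof -
      show "odd m" using assms mN by (metis even_mult_iff even_of_nat)
      thus "m > 0" by (simp add: m_def) (metis even_zero gr0I of_nat_0)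
    qed
    have n2: "[n = 2] (mod m)" by (simp add: n_def mN cong_iff_dvd_diff)
    have "odd n" using n4 by presburger
    have "coprime m n"
      using cong_imp_coprime[OF cong_sym[OF n2]] m(2) by (simp add: coprime_commute)
    hence "kronecker m n = kronecker n m * recip_sign m n"
      using kronecker_reciprocity[of m n] m \<open>odd n\<close> by simp
    also have "\<dots> = kronecker 2 m"
      using n4 kronecker_cong_left_odd[OF m n2] by (simp add: recip_sign_def)
    also have "\<dots> = kronecker m 2" using kronecker_2_right[of m] m by simp
    finally show ?thesis by (simp add: m_def)
  qed
  thus ?thesis unfolding eta_character_def n_def[symmetric] by simp
qed

text \<open>Factors 2 are removed one at a time, each being replaced by the odd number of
  \<open>eta_character_2\<close>; an even \<open>a\<close> coprime to \<open>N\<close> forces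
  \<open>N\<close> odd.\<close>

lemma eta_character_odd_representative:
  assumes "coprime a (int N)"
  shows "\<exists>a'. odd a' \<and> [a' = a] (mod int N) \<and> eta_character N r a' = eta_character N r a"
  using assms
proof (induction "nat \<bar>a\<bar>" arbitrary: a rule: less_induct)
  case less
  show ?case
  proof (cases "odd a")
    case False
    hence "odd N" using less.prems by (metis coprime_common_divisor even_of_nat odd_one)
    show ?thesis
    proof (cases "a = 0")
      case True
      hence "N = 1" using less.prems by auto
      thus ?thesis by (intro exI[of _ 1]) (simp add: eta_character_def)
    next
      case nz: False
      obtain a1 where a1: "a = 2 * a1" using False by blast
      have cop: "coprime a1 (int N)" "coprime 2 (int N)" using less.prems a1 by simp_all
      obtain b where b: "odd b" "[b = a1] (mod int N)" "eta_character N r b = eta_character N r a1"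
        using less.hyps[of a1] cop(1) nz a1 by (auto simp: abs_mult)
      define n where "n = 2 + 3 * int N * int N"
      have n: "[n = 2] (mod int N)" by (simp add: n_def cong_iff_dvd_diff)
      have "coprime n (int N)" "coprime b (int N)"
        using cong_imp_coprime[OF cong_sym[OF n]] cong_imp_coprime[OF cong_sym[OF b(2)]] cop by auto
      hence "eta_character N r (n * b) = eta_character N r n * eta_character N r b"
        by (rule eta_character_mult)
      also have "\<dots> = eta_character N r 2 * eta_character N r a1"
        using eta_character_2[OF \<open>odd N\<close>, of r] b(3) by (simp add: n_def)
      also have "\<dots> = eta_character N r a"
        unfolding a1 by (rule eta_character_mult[symmetric]) (use cop in auto)
      finally show ?thesis
        using b(1) \<open>odd N\<close> cong_mult[OF n b(2)]
        by (intro exI[of _ "n * b"]) (simp add: a1 n_def)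
    qed
  qed auto
qed

lemma eta_character_cong:
  assumes "N > 0"
    and sum1: "[(\<Sum>\<delta> | \<delta> dvd N. r \<delta> * int \<delta>) = 0] (mod 24)"
    and sum2: "[(\<Sum>\<delta> | \<delta> dvd N. r \<delta> * int (N div \<delta>)) = 0] (mod 24)"
    and sum0: "(\<Sum>\<delta> | \<delta> dvd N. r \<delta>) = 0"
    and a: "coprime a (int N)" and ab: "[a = b] (mod int N)"
  shows "eta_character N r a = eta_character N r b"
proof -
  have b: "coprime b (int N)" using cong_imp_coprime[OF ab a] .
  obtain a' where a': "odd a'" "[a' = a] (mod int N)" "eta_character N r a' = eta_character N r a"
    using eta_character_odd_representative[OF a] by blast
  obtain b' where b': "odd b'" "[b' = b] (mod int N)" "eta_character N r b' = eta_character N r b"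
    using eta_character_odd_representative[OF b] by blast
  have "eta_character N r a' = eta_character N r b'"
  proof (rule eta_character_cong_odd[OF assms(1-4)])
    show "coprime a' (int N)" using cong_imp_coprime[OF cong_sym[OF a'(2)] a] .
    show "[a' = b'] (mod int N)" using a'(2) ab b'(2) by (meson cong_sym cong_trans)
  qed (use a' b' in auto)
  thus ?thesis using a' b' by simp
qed

text \<open>If \<open>a\<close> is even then \<open>c\<close> is odd and T A has the odd entry a +
  c. Translation leaves the quotient unchanged, and the character agrees at a and a + c because
  \<open>N\<close> divides \<open>c\<close>.\<close>

lemma eta_quotient_transform:
  assumes "N > 0"
    and sum1: "[(\<Sum>\<delta> | \<delta> dvd N. r \<delta> * int \<delta>) = 0] (mod 24)"
    and sum2: "[(\<Sum>\<delta> | \<delta> dvd N. r \<delta> * int (N div \<delta>)) = 0] (mod 24)"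
    and sum0: "(\<Sum>\<delta> | \<delta> dvd N. r \<delta>) = 0"
    and det: "a * d - b * c = 1" and Nc: "int N dvd c" and z: "Im z > 0"
  shows "eta_quotient N r ((of_int a * z + of_int b) / (of_int c * z + of_int d)) =
         eta_character N r a * eta_quotient N r z"
proof (cases "odd a")
  case True
  thus ?thesis using eta_quotient_transform_odd[OF assms(1-6) True z] by simp
next
  case False
  note transform = eta_quotient_transform_odd[OF assms(1-4)]
  have "odd c"
  proof
    assume "even c"
    hence "even (a * d - b * c)" using False by simp
    thus False using det by simp
  qed
  have det': "(a + c) * d - (b + d) * c = 1" using det by (simp add: algebra_simps)
  define v where "v = of_int c * z + of_int d"
  define w where "w = (of_int a * z + of_int b) / v"
  have v: "v \<noteq> 0" unfolding v_def by (rule automorphy_nonzero[OF det z])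
  have w: "Im w > 0" unfolding w_def v_def by (rule Im_moebius_pos[OF det z])
  have "coprime a (int N)"
  proof (rule coprimeI)
    fix e assume "e dvd a" "e dvd int N"
    hence "e dvd a * d - b * c" using Nc by (intro dvd_diff) (auto intro: dvd_trans)
    thus "is_unit e" using det by simp
  qed
  hence chi: "eta_character N r a = eta_character N r (a + c)"
    by (rule eta_character_cong[OF assms(1-4)]) (use Nc in \<open>simp add: cong_iff_dvd_diff\<close>)
  have "eta_quotient N r w = eta_quotient N r ((of_int 1 * w + of_int 1) / (of_int 0 * w + of_int 1))"
    using transform[of 1 1 1 0 w] w by simp
  also have "(of_int 1 * w + of_int 1) / (of_int 0 * w + of_int 1) = (of_int (a + c) * z + of_int (b + d)) / v"
    using v by (simp add: w_def field_simps) (simp add: v_def algebra_simps)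
  also have "eta_quotient N r \<dots> = eta_character N r (a + c) * eta_quotient N r z"
    unfolding v_def by (rule transform[OF det' Nc _ z]) (use False \<open>odd c\<close> in simp)
  finally show ?thesis by (simp add: chi w_def v_def)
qed

section \<open>Holomorphy and behaviour at the cusps\<close>

lemma eta_quotient_holomorphic:
  assumes "N > 0"
  shows "eta_quotient N r holomorphic_on upper_half_plane"
  unfolding eta_quotient_def [abs_def]
proof (intro holomorphic_on_prod holomorphic_on_power_int)
  fix \<delta> assume "\<delta> \<in> {\<delta>. \<delta> dvd N}"
  hence \<delta>: "\<delta> > 0" using assms by (auto intro: dvd_pos_nat)
  have "(dedekind_eta \<circ> (\<lambda>z. of_nat \<delta> * z)) holomorphic_on upper_half_plane"
    by (rule holomorphic_on_compose_gen[OF _ dedekind_eta_holomorphic])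
       (use \<delta> in \<open>auto intro!: holomorphic_intros simp: upper_half_plane_def\<close>)
  thus "(\<lambda>z. dedekind_eta (of_nat \<delta> * z)) holomorphic_on upper_half_plane" by (simp only: o_def)
  show "0 \<le> r \<delta> \<or> (\<forall>z\<in>upper_half_plane. dedekind_eta (of_nat \<delta> * z) \<noteq> 0)"
    using dedekind_eta_nonzero \<delta> by (auto simp: upper_half_plane_def)
qed

text \<open>Squaring replaces the root by cz + d. The constant \<kappa> stays anonymous, as only its
  independence of z counts; even \<open>a\<close> is reduced to odd \<open>a\<close> by one
  translation.\<close>

lemma dedekind_eta_square_transform:
  assumes det: "a * d - b * c = 1"
  shows "\<exists>\<kappa>. \<forall>z. Im z > 0 \<longrightarrow>
    (dedekind_eta ((of_int a * z + of_int b) / (of_int c * z + of_int d)))\<^sup>2 =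
    \<kappa> * (of_int c * z + of_int d) * (dedekind_eta z)\<^sup>2"
proof (cases "odd a")
  case True
  from eta_transforms_odd[OF True det] show ?thesis
    unfolding eta_transforms_def
    by (intro exI[of _ "(of_int (kronecker c a) * exp (of_real pi * \<i> * of_int (eta_exponent a b c d) / 12))\<^sup>2"])
       (simp add: power_mult_distrib)
next
  case False
  have "odd c"
  proof
    assume "even c"
    hence "even (a * d - b * c)" using False by simp
    thus False using det by simp
  qed
  have det': "(a + c) * d - (b + d) * c = 1" using det by (simp add: algebra_simps)
  define \<epsilon> where "\<epsilon> = exp (of_real pi * \<i> * of_int 1 / 12)"
  define \<kappa> where "\<kappa> = (of_int (kronecker c (a + c)) * exp (of_real pi * \<i> * of_int (eta_exponent (a + c) (b + d) c d) / 12))\<^sup>2"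
  have "(dedekind_eta ((of_int a * z + of_int b) / (of_int c * z + of_int d)))\<^sup>2 =
    \<kappa> / \<epsilon>\<^sup>2 * (of_int c * z + of_int d) * (dedekind_eta z)\<^sup>2" if z: "Im z > 0" for z
  proof -
    define v where "v = of_int c * z + of_int d"
    define w where "w = (of_int a * z + of_int b) / v"
    have v: "v \<noteq> 0" unfolding v_def by (rule automorphy_nonzero[OF det z])
    have "(of_int (a + c) * z + of_int (b + d)) / v = w + of_int 1"
      using v by (simp add: w_def field_simps) (simp add: v_def algebra_simps)
    hence "\<epsilon> * dedekind_eta w = dedekind_eta ((of_int (a + c) * z + of_int (b + d)) / v)"
      by (simp only: dedekind_eta_add_int \<epsilon>_def)
    also have "\<dots> = of_int (kronecker c (a + c)) * exp (of_real pi * \<i> * of_int (eta_exponent (a + c) (b + d) c d) / 12)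
       * csqrt v * dedekind_eta z"
      using eta_transforms_odd[OF _ det'] False \<open>odd c\<close> z unfolding eta_transforms_def v_def by auto
    finally have "(\<epsilon> * dedekind_eta w)\<^sup>2 = \<kappa> * v * (dedekind_eta z)\<^sup>2"
      by (simp add: power_mult_distrib \<kappa>_def)
    moreover have "\<epsilon> \<noteq> 0" by (simp add: \<epsilon>_def)
    ultimately show ?thesis
      unfolding w_def[symmetric] v_def[symmetric] by (simp add: power_mult_distrib field_simps)
  qed
  thus ?thesis by blast
qed

lemma Im_divide_of_int: "Im (z / of_int n) = Im z / of_int n"
  using Im_divide_of_real[of z "of_int n"] by simp

text \<open>The matrix \<open>(\<delta>a, \<delta>b; c, d)\<close> of determinant \<open>\<delta>\<close> is an element of \<open>SL\<^sub>2(\<int>)\<close> times an upper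
  triangular matrix \<open>(\<alpha>, \<beta>; 0, \<epsilon>)\<close>.\<close>

lemma dedekind_eta_square_at_cusp:
  assumes det: "a * d - b * c = (1::int)" and "\<delta> > 0"
  shows "\<exists>\<alpha> \<beta> \<epsilon> \<kappa>. \<alpha> > 0 \<and> \<epsilon> > 0 \<and> \<alpha> * \<epsilon> = \<delta> \<and> (\<forall>z. Im z > 0 \<longrightarrow>
     (dedekind_eta (of_int \<delta> * ((of_int a * z + of_int b) / (of_int c * z + of_int d))))\<^sup>2 =
     \<kappa> * (of_int c * z + of_int d) * (dedekind_eta ((of_int \<alpha> * z + of_int \<beta>) / of_int \<epsilon>))\<^sup>2)"
proof -
  \<comment> \<open>The first column (\<delta>a, c) is \<alpha> times a primitive vector (p, q),
    which the Bezout coefficients complete to the matrix (p, -u; q, t) of determinant 1.\<close>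
  define \<alpha> where "\<alpha> = gcd (\<delta> * a) c"
  have "\<delta> * a \<noteq> 0 \<or> c \<noteq> 0" using det assms(2) by auto
  hence \<alpha>: "\<alpha> > 0" by (simp add: \<alpha>_def)
  obtain p q where pq: "\<delta> * a = \<alpha> * p" "c = \<alpha> * q"
    unfolding \<alpha>_def by (meson dvdE gcd_dvd1 gcd_dvd2)
  obtain t u where "t * (\<delta> * a) + u * c = \<alpha>" using bezout_int unfolding \<alpha>_def by blast
  hence "\<alpha> * (t * p + u * q) = \<alpha> * 1" by (simp add: pq algebra_simps)
  hence tu: "t * p + u * q = 1" using \<alpha> by (simp only: mult_cancel_left) simp
  define \<beta> where "\<beta> = t * (\<delta> * b) + u * d"
  define \<epsilon> where "\<epsilon> = p * d - q * (\<delta> * b)"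
  have "\<alpha> * \<epsilon> = (\<alpha> * p) * d - (\<alpha> * q) * (\<delta> * b)" by (simp add: \<epsilon>_def algebra_simps)
  also have "\<dots> = \<delta> * (a * d - b * c)" unfolding pq[symmetric] by (simp add: algebra_simps)
  finally have \<epsilon>: "\<alpha> * \<epsilon> = \<delta>" by (simp add: det)
  hence \<epsilon>0: "\<epsilon> > 0" using \<alpha> assms(2) by (metis zero_less_mult_pos)
  have det': "p * t - (-u) * q = 1" using tu by (simp add: mult_ac)
  obtain \<kappa> where \<kappa>: "\<And>z. Im z > 0 \<Longrightarrow> (dedekind_eta ((of_int p * z + of_int (-u)) / (of_int q * z + of_int t)))\<^sup>2 =
    \<kappa> * (of_int q * z + of_int t) * (dedekind_eta z)\<^sup>2"
    using dedekind_eta_square_transform[OF det'] by blast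
  have e1: "p * \<beta> - u * \<epsilon> = \<delta> * b"
  proof -
    have "p * \<beta> - u * \<epsilon> = \<delta> * b * (t * p + u * q)" by (simp add: \<beta>_def \<epsilon>_def algebra_simps)
    thus ?thesis by (simp add: tu)
  qed
  have e2: "q * \<beta> + t * \<epsilon> = d"
  proof -
    have "q * \<beta> + t * \<epsilon> = d * (t * p + u * q)" by (simp add: \<beta>_def \<epsilon>_def algebra_simps)
    thus ?thesis by (simp add: tu)
  qed
  have "(dedekind_eta (of_int \<delta> * ((of_int a * z + of_int b) / (of_int c * z + of_int d))))\<^sup>2 =
     \<kappa> / of_int \<epsilon> * (of_int c * z + of_int d) * (dedekind_eta ((of_int \<alpha> * z + of_int \<beta>) / of_int \<epsilon>))\<^sup>2"
    if z: "Im z > 0" for z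
  proof -
    define x where "x = (of_int \<alpha> * z + of_int \<beta>) / of_int \<epsilon>"
    define e :: complex where "e = of_int \<epsilon>"
    have e: "e \<noteq> 0" using \<epsilon>0 by (simp add: e_def)
    have x: "Im x > 0" unfolding x_def using z \<alpha> \<epsilon>0 by (simp add: Im_divide_of_int)
    have xe: "x * e = of_int \<alpha> * z + of_int \<beta>" using e by (simp add: x_def e_def)
    have "(of_int p * x + of_int (-u)) * e = of_int p * (x * e) - of_int u * e"
      by (simp add: algebra_simps)
    also have "\<dots> = of_int (\<alpha> * p) * z + of_int (p * \<beta> - u * \<epsilon>)"
      unfolding xe by (simp add: e_def algebra_simps)
    also have "\<dots> = of_int \<delta> * (of_int a * z + of_int b)"
      unfolding e1 pq[symmetric] by (simp add: algebra_simps)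
    finally have num: "(of_int p * x + of_int (-u)) * e = of_int \<delta> * (of_int a * z + of_int b)" .
    have "(of_int q * x + of_int t) * e = of_int q * (x * e) + of_int t * e"
      by (simp add: algebra_simps)
    also have "\<dots> = of_int (\<alpha> * q) * z + of_int (q * \<beta> + t * \<epsilon>)"
      unfolding xe by (simp add: e_def algebra_simps)
    also have "\<dots> = of_int c * z + of_int d" unfolding e2 pq[symmetric] ..
    finally have den: "(of_int q * x + of_int t) * e = of_int c * z + of_int d" .
    have "of_int \<delta> * ((of_int a * z + of_int b) / (of_int c * z + of_int d)) =
          (of_int p * x + of_int (-u)) * e / ((of_int q * x + of_int t) * e)"
      unfolding num den by simp
    also have "\<dots> = (of_int p * x + of_int (-u)) / (of_int q * x + of_int t)"
      using e by simp
    finally have "(dedekind_eta (of_int \<delta> * ((of_int a * z + of_int b) / (of_int c * z + of_int d))))\<^sup>2 =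
        \<kappa> * (of_int q * x + of_int t) * (dedekind_eta x)\<^sup>2"
      using \<kappa>[OF x] by simp
    also have "of_int q * x + of_int t = (of_int c * z + of_int d) / e"
      using den e by (simp add: field_simps)
    finally show ?thesis by (simp add: x_def e_def)
  qed
  thus ?thesis using \<alpha> \<epsilon>0 \<epsilon> by blast
qed

text \<open>The values lie among two numbers, and a continuous function on a connected set cannot
  jump between them.\<close>

lemma continuous_square_const_imp_const:
  fixes f :: "complex \<Rightarrow> complex"
  assumes "connected S" "continuous_on S f" "\<And>z. z \<in> S \<Longrightarrow> (f z)\<^sup>2 = k"
  shows "\<exists>C. \<forall>z\<in>S. f z = C"
proof -
  have "f ` S \<subseteq> {csqrt k, - csqrt k}"
  proof (rule image_subsetI)
    fix z assume "z \<in> S"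
    hence "(f z)\<^sup>2 = (csqrt k)\<^sup>2" using assms(3) by simp
    thus "f z \<in> {csqrt k, - csqrt k}" by (simp only: power2_eq_iff) simp
  qed
  hence "finite (f ` S)" by (rule finite_subset) auto
  thus ?thesis
    using continuous_finite_range_constant[OF assms(1,2)] by (auto simp: constant_on_def)
qed

text \<open>Up to a constant the quotient at Az is a product of powers of eta at upper triangular
  images of z, and each of these etas is a power series in exp(2 pi i z/(24N)).\<close>

lemma eta_quotient_meromorphic_at_cusp:
  assumes "N > 0" and sum0: "(\<Sum>\<delta> | \<delta> dvd N. r \<delta>) = 0" and det: "a * d - b * c = (1::int)"
  shows "\<exists>F. F meromorphic_on {0} \<and> (\<forall>z. Im z > 0 \<longrightarrow>
    eta_quotient N r ((of_int a * z + of_int b) / (of_int c * z + of_int d)) =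
    F (exp (2 * of_real pi * \<i> * z / of_nat (24 * N))))"
proof -
  define D where "D = {\<delta>. \<delta> dvd N}"
  have D: "finite D" using assms(1) by (simp add: D_def)
  define A where "A = (\<lambda>z::complex. (of_int a * z + of_int b) / (of_int c * z + of_int d))"
  have "\<forall>\<delta>\<in>D. \<exists>\<alpha> \<beta> \<epsilon> \<kappa>. \<alpha> > 0 \<and> \<epsilon> > 0 \<and> \<alpha> * \<epsilon> = int \<delta> \<and> (\<forall>z. Im z > 0 \<longrightarrow>
     (dedekind_eta (of_int (int \<delta>) * A z))\<^sup>2 =
     \<kappa> * (of_int c * z + of_int d) * (dedekind_eta ((of_int \<alpha> * z + of_int \<beta>) / of_int \<epsilon>))\<^sup>2)"
    unfolding A_def using dedekind_eta_square_at_cusp[OF det] assms(1)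
    by (metis D_def dvd_pos_nat mem_Collect_eq of_nat_0_less_iff)
  then obtain \<alpha> \<beta> \<epsilon> \<kappa> where *: "\<And>\<delta>. \<delta> \<in> D \<Longrightarrow> \<alpha> \<delta> > 0 \<and> \<epsilon> \<delta> > 0 \<and> \<alpha> \<delta> * \<epsilon> \<delta> = int \<delta> \<and>
     (\<forall>z. Im z > 0 \<longrightarrow> (dedekind_eta (of_int (int \<delta>) * A z))\<^sup>2 =
       \<kappa> \<delta> * (of_int c * z + of_int d) * (dedekind_eta ((of_int (\<alpha> \<delta>) * z + of_int (\<beta> \<delta>)) / of_int (\<epsilon> \<delta>)))\<^sup>2)"
    by metis
  define u where "u = (\<lambda>\<delta> z. (of_int (\<alpha> \<delta>) * z + of_int (\<beta> \<delta>)) / of_int (\<epsilon> \<delta>) :: complex)"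
  have pos: "\<alpha> \<delta> > 0" "\<epsilon> \<delta> > 0" "\<alpha> \<delta> * \<epsilon> \<delta> = int \<delta>" if "\<delta> \<in> D" for \<delta>
    using *[OF that] by auto
  have sq: "(dedekind_eta (of_nat \<delta> * A z))\<^sup>2 = \<kappa> \<delta> * (of_int c * z + of_int d) * (dedekind_eta (u \<delta> z))\<^sup>2"
    if "\<delta> \<in> D" "Im z > 0" for \<delta> z
    using *[OF that(1)] that(2) by (simp add: u_def)
  have Imu: "Im (u \<delta> z) > 0" if "\<delta> \<in> D" "Im z > 0" for \<delta> z
    using pos[OF that(1)] that(2) by (simp add: u_def Im_divide_of_int)
  have ImA: "Im (A z) > 0" if "Im z > 0" for z
    unfolding A_def by (rule Im_moebius_pos[OF det that])
  define G where "G = (\<lambda>z. \<Prod>\<delta>\<in>D. dedekind_eta (u \<delta> z) powi r \<delta>)"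
  have G0: "G z \<noteq> 0" if "Im z > 0" for z
    using dedekind_eta_nonzero[OF Imu[OF _ that]] D by (auto simp: G_def)
  \<comment> \<open>The factors cz + d carry the total exponent 0, so only constants remain in the
    square.\<close>
  have sqr: "(eta_quotient N r (A z) / G z)\<^sup>2 = (\<Prod>\<delta>\<in>D. \<kappa> \<delta> powi r \<delta>)" if z: "Im z > 0" for z
  proof -
    have pw: "(x powi k)\<^sup>2 = (x\<^sup>2) powi k" for x :: complex and k
      by (simp add: power2_eq_square power_int_mult_distrib)
    have "(eta_quotient N r (A z))\<^sup>2 = (\<Prod>\<delta>\<in>D. (\<kappa> \<delta> * (of_int c * z + of_int d) * (dedekind_eta (u \<delta> z))\<^sup>2) powi r \<delta>)"
      unfolding eta_quotient_def D_def[symmetric] prod_power_distrib pw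
      by (intro prod.cong refl) (simp add: sq z)
    also have "\<dots> = (\<Prod>\<delta>\<in>D. \<kappa> \<delta> powi r \<delta>) * (\<Prod>\<delta>\<in>D. (of_int c * z + of_int d) powi r \<delta>) * (G z)\<^sup>2"
      unfolding power_int_mult_distrib prod.distrib G_def prod_power_distrib pw ..
    also have "(\<Prod>\<delta>\<in>D. (of_int c * z + of_int d) powi r \<delta>) = 1"
      using automorphy_nonzero[OF det z] sum0 by (simp add: prod_power_int_sum D_def)
    finally show ?thesis using G0[OF z] by (simp add: power_divide)
  qed
  have "\<exists>C. \<forall>z\<in>upper_half_plane. eta_quotient N r (A z) / G z = C"
  proof (rule continuous_square_const_imp_const[OF connected_upper_half_plane])
    have "continuous_on upper_half_plane (eta_quotient N r \<circ> A)"
    proof (rule continuous_on_compose)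
      show "continuous_on upper_half_plane A" unfolding A_def
        by (intro continuous_intros ballI automorphy_nonzero[OF det]) (auto simp: upper_half_plane_def)
      show "continuous_on (A ` upper_half_plane) (eta_quotient N r)"
        by (rule continuous_on_subset[OF holomorphic_on_imp_continuous_on[OF eta_quotient_holomorphic[OF assms(1)]]])
           (use ImA in \<open>auto simp: upper_half_plane_def\<close>)
    qed
    moreover have "continuous_on upper_half_plane G"
      unfolding G_def
    proof (intro continuous_on_prod continuous_on_power_int)
      fix \<delta> assume \<delta>: "\<delta> \<in> D"
      have "continuous_on upper_half_plane (dedekind_eta \<circ> u \<delta>)"
      proof (rule continuous_on_compose)
        show "continuous_on upper_half_plane (u \<delta>)" unfolding u_def
          using pos[OF \<delta>] by (intro continuous_intros) auto
        show "continuous_on (u \<delta> ` upper_half_plane) dedekind_eta"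
          by (rule continuous_on_subset[OF holomorphic_on_imp_continuous_on[OF dedekind_eta_holomorphic]])
             (use Imu[OF \<delta>] in \<open>auto simp: upper_half_plane_def\<close>)
      qed
      thus "continuous_on upper_half_plane (\<lambda>z. dedekind_eta (u \<delta> z))" by (simp only: o_def)
      show "0 \<le> r \<delta> \<or> (\<forall>z\<in>upper_half_plane. dedekind_eta (u \<delta> z) \<noteq> 0)"
        using dedekind_eta_nonzero[OF Imu[OF \<delta>]] by (auto simp: upper_half_plane_def)
    qed
    ultimately show "continuous_on upper_half_plane (\<lambda>z. eta_quotient N r (A z) / G z)"
      unfolding o_def by (intro continuous_on_divide) (use G0 in \<open>auto simp: upper_half_plane_def\<close>)
    show "(eta_quotient N r (A z) / G z)\<^sup>2 = (\<Prod>\<delta>\<in>D. \<kappa> \<delta> powi r \<delta>)" if "z \<in> upper_half_plane" for z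
      using sqr that by (simp add: upper_half_plane_def)
  qed
  then obtain C where C: "\<And>z. Im z > 0 \<Longrightarrow> eta_quotient N r (A z) = C * G z"
    using G0 by (fastforce simp: upper_half_plane_def field_simps)
  \<comment> \<open>Chosen so that \<alpha>/\<epsilon> = k/N, which is possible as \<epsilon>
    divides \<delta> and hence \<open>N\<close>; the single width 24N then works for every
    \<delta>.\<close>
  define k where "k = (\<lambda>\<delta>. nat (\<alpha> \<delta>) * (N div nat (\<epsilon> \<delta>)))"
  define P where "P = (\<lambda>\<delta> x. exp (2 * of_real pi * \<i> * (of_int (\<beta> \<delta>) / of_int (\<epsilon> \<delta>)) / 24) * x ^ k \<delta>)"
  \<comment> \<open>With x = exp(2 pi i z/(24N)), P is q^(1/24) and P^24 is q at the point u, so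
    this is eta at u written as a function of x.\<close>
  define H where "H = (\<lambda>\<delta> x. P \<delta> x * qpoch (P \<delta> x ^ 24) (P \<delta> x ^ 24))"
  define F where "F = (\<lambda>x. C * (\<Prod>\<delta>\<in>D. H \<delta> x powi r \<delta>))"
  have eps: "int (N div nat (\<epsilon> \<delta>)) * \<epsilon> \<delta> = int N" "k \<delta> > 0" if \<delta>: "\<delta> \<in> D" for \<delta>
  proof -
    have "int (nat (\<epsilon> \<delta>)) dvd int \<delta>" using pos[OF \<delta>] by (metis dvd_triv_right int_nat_eq less_imp_le)
    hence "nat (\<epsilon> \<delta>) dvd \<delta>" by (simp only: of_nat_dvd_iff)
    hence dv: "nat (\<epsilon> \<delta>) dvd N" using \<delta> by (auto simp: D_def intro: dvd_trans)
    hence "N div nat (\<epsilon> \<delta>) * nat (\<epsilon> \<delta>) = N" by simp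
    thus "int (N div nat (\<epsilon> \<delta>)) * \<epsilon> \<delta> = int N"
      using pos[OF \<delta>] by (metis int_nat_eq less_imp_le of_nat_mult)
    show "k \<delta> > 0" using dv pos[OF \<delta>] assms(1)
      by (auto simp: k_def div_greater_zero_iff dvd_imp_le)
  qed
  have H_eta: "H \<delta> (exp (2 * of_real pi * \<i> * z / of_nat (24 * N))) = dedekind_eta (u \<delta> z)"
    if \<delta>: "\<delta> \<in> D" for \<delta> z
  proof -
    define x where "x = exp (2 * of_real pi * \<i> * z / of_nat (24 * N))"
    have kk: "of_nat (k \<delta>) * of_int (\<epsilon> \<delta>) = (of_int (\<alpha> \<delta>) * of_nat N :: complex)"
    proof -
      have "int (k \<delta>) * \<epsilon> \<delta> = \<alpha> \<delta> * (int (N div nat (\<epsilon> \<delta>)) * \<epsilon> \<delta>)"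
        using pos[OF \<delta>] by (simp add: k_def)
      also have "\<dots> = \<alpha> \<delta> * int N" by (simp only: eps[OF \<delta>])
      finally have "of_int (int (k \<delta>) * \<epsilon> \<delta>) = (of_int (\<alpha> \<delta> * int N) :: complex)" by (simp only:)
      thus ?thesis by simp
    qed
    have nz: "of_int (\<epsilon> \<delta>) \<noteq> (0::complex)" "of_nat N \<noteq> (0::complex)" using pos[OF \<delta>] assms(1) by auto
    have quot: "of_nat (k \<delta>) / of_nat N = of_int (\<alpha> \<delta>) / (of_int (\<epsilon> \<delta>) :: complex)"
      using kk nz by (simp add: frac_eq_eq)
    have "of_nat (k \<delta>) * (2 * of_real pi * \<i> * z / of_nat (24 * N)) =
          2 * of_real pi * \<i> * (of_nat (k \<delta>) / of_nat N * z) / 24"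
      using nz(2) by (simp add: field_simps)
    hence "of_nat (k \<delta>) * (2 * of_real pi * \<i> * z / of_nat (24 * N)) =
          2 * of_real pi * \<i> * (of_int (\<alpha> \<delta>) / of_int (\<epsilon> \<delta>) * z) / 24"
      by (simp only: quot)
    hence "x ^ k \<delta> = exp (2 * of_real pi * \<i> * (of_int (\<alpha> \<delta>) / of_int (\<epsilon> \<delta>) * z) / 24)"
      by (simp only: x_def exp_of_nat_mult[symmetric])
    hence P: "P \<delta> x = exp (2 * of_real pi * \<i> * u \<delta> z / 24)"
      unfolding P_def by (simp add: u_def add_divide_distrib algebra_simps flip: exp_add)
    have "P \<delta> x ^ 24 = exp (2 * of_real pi * \<i> * u \<delta> z)"
      unfolding P by (simp add: mult_ac flip: exp_of_nat_mult)
    thus ?thesis unfolding H_def x_def[symmetric] dedekind_eta_qpoch by (simp only: P)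
  qed
  \<comment> \<open>Each H is analytic on the unit disc because |P| = |x|^k < 1 there; negative
    exponents then cost only meromorphy at 0.\<close>
  have "F meromorphic_on {0}"
    unfolding F_def
  proof (intro meromorphic_intros)
    fix \<delta> assume \<delta>: "\<delta> \<in> D"
    have "H \<delta> holomorphic_on ball 0 1"
      unfolding H_def
    proof (intro holomorphic_on_mult qpoch_holomorphic)
      show "P \<delta> holomorphic_on ball 0 1" "(\<lambda>x. P \<delta> x ^ 24) holomorphic_on ball 0 1"
        "(\<lambda>x. P \<delta> x ^ 24) holomorphic_on ball 0 1"
        unfolding P_def by (intro holomorphic_intros)+
      show "norm (P \<delta> x ^ 24) < 1" if "x \<in> ball 0 1" for x
      proof -
        have "2 * of_real pi * \<i> * (of_int (\<beta> \<delta>) / of_int (\<epsilon> \<delta>)) / 24 =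
            \<i> * of_real (2 * pi * (of_int (\<beta> \<delta>) / of_int (\<epsilon> \<delta>)) / 24)" by simp
        hence "norm (P \<delta> x) = norm x ^ k \<delta>"
          by (simp only: P_def norm_mult norm_power norm_exp_i_times mult_1_left)
        also have "\<dots> < 1" using that eps(2)[OF \<delta>] by (simp add: power_less_one_iff)
        finally show ?thesis by (simp add: norm_power power_less_one_iff)
      qed
    qed auto
    hence "H \<delta> analytic_on ball 0 1" by (simp add: analytic_on_open)
    hence "H \<delta> analytic_on {0}" by (rule analytic_on_subset) auto
    thus "H \<delta> meromorphic_on {0}" by (rule analytic_on_imp_meromorphic_on)
  qed
  moreover have "eta_quotient N r (A z) = F (exp (2 * of_real pi * \<i> * z / of_nat (24 * N)))" if "Im z > 0" for z
    unfolding C[OF that] F_def G_def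
    by (intro arg_cong2[where f = "(*)"] prod.cong refl) (simp only: H_eta)
  ultimately show ?thesis unfolding A_def by blast
qed

theorem theorem3:
  fixes N :: nat and r :: "nat \<Rightarrow> int"
  assumes "N > 0"
    and "[(\<Sum>\<delta> | \<delta> dvd N. r \<delta> * int \<delta>) = 0] (mod 24)"
    and "[(\<Sum>\<delta> | \<delta> dvd N. r \<delta> * int (N div \<delta>)) = 0] (mod 24)"
    and "(\<Sum>\<delta> | \<delta> dvd N. r \<delta>) = 0"
  shows "modular_function_Gamma0 N (eta_character N r) (eta_quotient N r)"
  unfolding modular_function_Gamma0_def
proof (intro conjI ballI)
  show "quadratic_character N (eta_character N r)"
    unfolding quadratic_character_def
    using eta_character_values eta_character_mult eta_character_cong[OF assms] by blast
  show "eta_quotient N r nicely_meromorphic_on upper_half_plane"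
    using eta_quotient_holomorphic[OF assms(1)] open_upper_half_plane
    by (intro analytic_on_imp_nicely_meromorphic_on) (simp add: analytic_on_open)
  show "meromorphic_at_cusps (eta_quotient N r)"
    unfolding meromorphic_at_cusps_def
  proof
    fix A :: "int ^ 2 ^ 2" assume "A \<in> SL2Z"
    hence "A $ 1 $ 1 * A $ 2 $ 2 - A $ 1 $ 2 * A $ 2 $ 1 = 1" by (simp add: SL2Z_def det_2)
    from eta_quotient_meromorphic_at_cusp[OF assms(1,4) this]
    obtain F where "F meromorphic_on {0}" "\<And>z. Im z > 0 \<Longrightarrow> eta_quotient N r (moebius A z) =
        F (exp (2 * of_real pi * \<i> * z / of_nat (24 * N)))"
      unfolding moebius_def by blast
    thus "\<exists>h::nat. h > 0 \<and> (\<exists>F y. F meromorphic_on {0} \<and> y > 0 \<and>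
        (\<forall>z. Im z > y \<longrightarrow> eta_quotient N r (moebius A z) = F (exp (2 * of_real pi * \<i> * z / of_nat h))))"
      \<comment> \<open>The expansion is valid on the whole upper half plane, so any positive height
        serves.\<close>
      using assms(1) by (intro exI[of _ "24 * N"] conjI exI[of _ F] exI[of _ "1::real"]) auto
  qed
  fix A :: "int ^ 2 ^ 2" and z assume "A \<in> Gamma0 N" "z \<in> upper_half_plane"
  thus "eta_quotient N r (moebius A z) = eta_character N r (A $ 1 $ 1) * eta_quotient N r z"
    unfolding moebius_def
    by (intro eta_quotient_transform[OF assms]) (auto simp: Gamma0_def SL2Z_def det_2 upper_half_plane_def)
qed

end
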